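(* Let $\{(\lambda^{(k)},\epsilon^{(k)},\tau^{(k)},\xi^{(k)})\}_{k\ge 1}$ be a sequence of positive parameters such that (i) $\lambda^{(k)}\searrow 0$; (ii) $\epsilon^{(k)}\searrow 0$ and there is $B>0$ with $\epsilon^{(k)}/(\lambda^{(k)})^2\le B$ for all $k\ge 1$; (iii) $\tau^{(k)}\searrow 0$, $\xi^{(k)}\searrow 0$, and $\tau^{(k)}/\lambda^{(k)}\to 0$, $\xi^{(k)}/\lambda^{(k)}\to 0$ as $k\to\infty$. Let $\{X^{(k)}\}_{k\ge1}$ be the corresponding sequence of $X$-iterates of Algorithm FALC. Then any limit point $\bar X$ of the sequence $\{X^{(k)}\}$ is an optimal solution of the problem $$\min_{X\in\mathbb{R}^{m\times n}}\ \mu_1\|\sigma(X)\|_\alpha+\mu_2\|\mathcal{C}(X)-d\|_\beta\quad\text{subject to}\quad \mathcal{A}(X)-b\in\mathcal{Q}.$$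
   Context: Setting: $\alpha,\beta\in\{1,2,\infty\}$; $\mu_1,\mu_2>0$; $\mathcal{A}:\mathbb{R}^{m\times n}\to\mathbb{R}^q$ is a surjective linear map and $\mathcal{C}:\mathbb{R}^{m\times n}\to\mathbb{R}^p$ is a linear map, represented by matrices via $\mathcal{A}(X)=A\,\mathrm{vec}(X)$, $\mathcal{C}(X)=C\,\mathrm{vec}(X)$; $b\in\mathbb{R}^q$, $d\in\mathbb{R}^p$; $\mathcal{Q}\subset\mathbb{R}^q$ is nonempty, closed and convex. $\sigma(X)$ is the vector of singular values of $X$, $\|\cdot\|_\alpha,\|\cdot\|_\beta$ are the vector $\ell_\alpha,\ell_\beta$ norms, and $\Pi_{\mathcal{Q}}$ is the Euclidean projection onto $\mathcal{Q}$. Let $I(\alpha)=\sqrt{\min\{m,n\}}$ if $\alpha=\infty$ and $1$ otherwise; $J(\beta)=\sqrt p$ if $\beta=\infty$ and $1$ otherwise. Let $M=\begin{pmatrix}-I&0&C\\0&-I&A\end{pmatrix}$ and $L=\sigma_{\max}(M)^2$, where $\sigma_{\max}$ is the largest singular value. $a^{(k)}\searrow 0$ means decreasing to $0$. Algorithm FALC. Input: positive parameters $\{(\lambda^{(k)},\epsilon^{(k)},\tau^{(k)},\xi^{(k)})\}_{k\ge1}$ and $X^{(0)}$ with $\mathcal{A}(X^{(0)})-b\in\mathcal{Q}$. Set $y^{(0)}=\mathcal{A}(X^{(0)})-b$, $s^{(0)}=\mathcal{C}(X^{(0)})-d$, $\eta=\mu_1\|\sigma(X^{(0)})\|_\alpha+\mu_2\|\mathcal{C}(X^{(0)})-d\|_\beta$,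 $\theta_1^{(1)}=0\in\mathbb{R}^q$, $\theta_2^{(1)}=0\in\mathbb{R}^p$. The iterations run over all $k=1,2,\dots$ (no global termination). In iteration $k$ let $$p^{(k)}(X,s,y)=\lambda^{(k)}(\mu_1\|\sigma(X)\|_\alpha+\mu_2\|s\|_\beta),$$ $$f^{(k)}(X,s,y)=\tfrac12\|\mathcal{A}(X)-y-b-\lambda^{(k)}\theta_1^{(k)}\|_2^2+\tfrac12\|\mathcal{C}(X)-s-d-\lambda^{(k)}\theta_2^{(k)}\|_2^2,$$ $P^{(k)}=p^{(k)}+f^{(k)}$ (the $k$-th subproblem is $\min\{P^{(k)}(X,s,y): X\in\mathbb{R}^{m\times n}, s\in\mathbb{R}^p, y\in\mathcal{Q}\}$), $\eta_1^{(k)}=\eta+\frac{\lambda^{(k)}}2(\|\theta_1^{(k)}\|_2^2+\|\theta_2^{(k)}\|_2^2)$, $\eta_2^{(k)}=\sigma_{\max}(A)\frac{I(\alpha)}{\mu_1}\eta_1^{(k)}+\|b+\lambda^{(k)}\theta_1^{(k)}\|_2+2\|\mathcal{A}(X^{(0)})-b\|_2$, $\mathcal{S}^{(k)}=\{(X,s,y):\mu_1\|\sigma(X)\|_\alpha\le\eta_1^{(k)},\ \mu_2\|s\|_\beta\le\eta_1^{(k)}\}$, and $$\ell_{\max}^{(k)}=\sqrt{\tfrac{2L}{\epsilon^{(k)}}}\Big[\Big(\tfrac{I(\alpha)}{\mu_1}+\tfrac{J(\beta)}{\mu_2}\Big)\eta_1^{(k)}+\eta_2^{(k)}+\|X^{(k-1)}\|_F+\|s^{(k-1)}\|_2+\|y^{(k-1)}\|_2\Big].$$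 Then $(X^{(k)},s^{(k)},y^{(k)})$ is the output of the following inner routine (Algorithm APG): put $z_1^{(0)}=z_2^{(1)}=(X^{(k-1)},s^{(k-1)},y^{(k-1)})$, $t^{(1)}=1$, $\ell=0$; while neither ITERstop nor GRADstop holds at the current $\ell$ and $z_1^{(\ell)}$, set $\ell\leftarrow\ell+1$, $$z_1^{(\ell)}=\mathrm{argmin}\big\{p^{(k)}(z)+\langle\nabla f^{(k)}(z_2^{(\ell)}),z-z_2^{(\ell)}\rangle+\tfrac L2\|z-z_2^{(\ell)}\|^2:\ z=(X,s,y)\in\mathcal{S}^{(k)},\ y\in\mathcal{Q}\big\},$$ $t^{(\ell+1)}=\big(1+\sqrt{1+4(t^{(\ell)})^2}\big)/2$, $z_2^{(\ell+1)}=z_1^{(\ell)}+\frac{t^{(\ell)}-1}{t^{(\ell+1)}}(z_1^{(\ell)}-z_1^{(\ell-1)})$; return $z_1^{(\ell)}$. Here $\|(X,s,y)\|^2=\|X\|_F^2+\|s\|_2^2+\|y\|_2^2$; ITERstop holds iff $\ell\ge\ell_{\max}^{(k)}$; GRADstop holds at $(X,s,y)$ iff both: there are $G\in\lambda^{(k)}\mu_1\,\partial\|\sigma(\cdot)\|_\alpha(X)+\nabla_Xf^{(k)}(X,s,y)$ and $g\in\lambda^{(k)}\mu_2\,\partial\|\cdot\|_\beta(s)+\nabla_sf^{(k)}(X,s,y)$ with $\sqrt{\|G\|_F^2+\|g\|_2^2}\le\tau^{(k)}$; and $\|y-\Pi_{\mathcal{Q}}(y-\frac1L\nabla_yf^{(k)}(X,s,y))\|_2\le\xi^{(k)}$.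 Finally the multipliers are updated by $\theta_1^{(k+1)}=\theta_1^{(k)}-\frac{\mathcal{A}(X^{(k)})-y^{(k)}-b}{\lambda^{(k)}}$ and $\theta_2^{(k+1)}=\theta_2^{(k)}-\frac{\mathcal{C}(X^{(k)})-s^{(k)}-d}{\lambda^{(k)}}$. *)

theory Defs
  imports
    "HOL-Analysis.Analysis"
    "HOL-Computational_Algebra.Polynomial"
begin

definition charpoly :: "real^'n^'n \<Rightarrow> real poly" where
  "charpoly M = det (\<chi> i j. (if i = j then [:0, 1:] else 0) - [:M $ i $ j:])"

text \<open>The vector of singular values of \<open>X\<close>, as a nonincreasing list of length \<open>min m n\<close>:
  the square roots of the \<open>n\<close> eigenvalues of \<open>X\<^sup>TX\<close>, repeated according to multiplicity.
  If \<open>m < n\<close>, the \<open>n - m\<close> values discarded at the end are all zero.\<close>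

definition singular_values :: "real^'n^'m \<Rightarrow> real list" where
  "singular_values X = take (min CARD('m) CARD('n))
     (rev (sorted_list_of_multiset (image_mset sqrt (proots (charpoly (transpose X ** X))))))"

definition sigma_max :: "real^'n^'m \<Rightarrow> real" where
  "sigma_max X = Max (set (singular_values X))"

definition lp_norm :: "enat \<Rightarrow> 'i set \<Rightarrow> ('i \<Rightarrow> real) \<Rightarrow> real" where
  "lp_norm r I v = (case r of
      enat k \<Rightarrow> root k (\<Sum>i\<in>I. \<bar>v i\<bar> ^ k)
    | \<infinity> \<Rightarrow> Max ((\<lambda>i. \<bar>v i\<bar>) ` I))"

definition vec_norm :: "enat \<Rightarrow> real^'p \<Rightarrow> real" where
  "vec_norm r v = lp_norm r UNIV (\<lambda>i. v $ i)"

definition sv_norm :: "enat \<Rightarrow> real^'n^'m \<Rightarrow> real" where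
  "sv_norm r X = lp_norm r {..<min CARD('m) CARD('n)} (\<lambda>i. singular_values X ! i)"

text \<open>The vectorization of \<open>X\<close>, indexed by pairs (column, row).\<close>

definition vectorize :: "real^'n^'m \<Rightarrow> real^('n \<times> 'm)" where
  "vectorize X = (\<chi> ji. X $ snd ji $ fst ji)"

definition gradient :: "('a::real_inner \<Rightarrow> real) \<Rightarrow> 'a \<Rightarrow> 'a" where
  "gradient f x = (THE D. GDERIV f x :> D)"

definition subdifferential :: "('a::real_inner \<Rightarrow> real) \<Rightarrow> 'a \<Rightarrow> 'a set" where
  "subdifferential f x = {g. \<forall>y. f x + inner g (y - x) \<le> f y}"

definition decreases_to_zero :: "(nat \<Rightarrow> real) \<Rightarrow> bool" where
  "decreases_to_zero a \<longleftrightarrow> (\<forall>k\<ge>1. a (Suc k) \<le> a k) \<and> a \<longlonglongrightarrow> 0"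

text \<open>The locale only fixes the problem data and the parameter sequences (used at indices
  \<open>k \<ge> 1\<close>); it makes no assumptions. Triples \<open>(X, s, y)\<close> carry the product inner product, so
  that \<open>norm\<close> is the square root of the sum of the squared Frobenius and Euclidean norms.\<close>

locale falc =
  fixes \<alpha> \<beta> :: enat
    and \<mu>\<^sub>1 \<mu>\<^sub>2 :: real
    and \<A> :: "real^'n^'m \<Rightarrow> real^'q" and A :: "real^('n \<times> 'm)^'q"
    and \<C> :: "real^'n^'m \<Rightarrow> real^'p" and C :: "real^('n \<times> 'm)^'p"
    and b :: "real^'q" and d :: "real^'p"
    and Q :: "(real^'q) set"
    and lam \<epsilon> \<tau> \<xi> :: "nat \<Rightarrow> real"
begin

definition objective :: "real^'n^'m \<Rightarrow> real" where
  "objective X = \<mu>\<^sub>1 * sv_norm \<alpha> X + \<mu>\<^sub>2 * vec_norm \<beta> (\<C> X - d)"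

definition I\<alpha> :: real where
  "I\<alpha> = (if \<alpha> = \<infinity> then sqrt (real (min CARD('m) CARD('n))) else 1)"

definition J\<beta> :: real where
  "J\<beta> = (if \<beta> = \<infinity> then sqrt (real CARD('p)) else 1)"

text \<open>The block matrix with rows \<open>(-I, 0, C)\<close> and \<open>(0, -I, A)\<close>; its columns correspond to
  \<open>s\<close>, \<open>y\<close> and \<open>vectorize X\<close>.\<close>

definition M :: "real^('p + 'q + 'n \<times> 'm)^('p + 'q)" where
  "M = (\<chi> r c. case (r, c) of
      (Inl i, Inl j) \<Rightarrow> (if i = j then - 1 else 0)
    | (Inl i, Inr (Inl j)) \<Rightarrow> 0
    | (Inl i, Inr (Inr v)) \<Rightarrow> C $ i $ v
    | (Inr i, Inl j) \<Rightarrow> 0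
    | (Inr i, Inr (Inl j)) \<Rightarrow> (if i = j then - 1 else 0)
    | (Inr i, Inr (Inr v)) \<Rightarrow> A $ i $ v)"

definition L :: real where
  "L = (sigma_max M)\<^sup>2"

definition p :: "nat \<Rightarrow> (real^'n^'m) \<times> (real^'p) \<times> (real^'q) \<Rightarrow> real" where
  "p k = (\<lambda>(X, s, y). lam k * (\<mu>\<^sub>1 * sv_norm \<alpha> X + \<mu>\<^sub>2 * vec_norm \<beta> s))"

text \<open>In what follows, \<open>u\<close> and \<open>w\<close> are the current multipliers \<open>\<theta>\<^sub>1 k\<close> and \<open>\<theta>\<^sub>2 k\<close>, and
  \<open>X0\<close> is the starting point of the outer algorithm.\<close>

definition f :: "nat \<Rightarrow> real^'q \<Rightarrow> real^'p
    \<Rightarrow> (real^'n^'m) \<times> (real^'p) \<times> (real^'q) \<Rightarrow> real" where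
  "f k u w = (\<lambda>(X, s, y). 1/2 * (norm (\<A> X - y - b - lam k *\<^sub>R u))\<^sup>2
                        + 1/2 * (norm (\<C> X - s - d - lam k *\<^sub>R w))\<^sup>2)"

definition \<eta>\<^sub>1 :: "real^'n^'m \<Rightarrow> nat \<Rightarrow> real^'q \<Rightarrow> real^'p \<Rightarrow> real" where
  "\<eta>\<^sub>1 X0 k u w = objective X0 + lam k / 2 * ((norm u)\<^sup>2 + (norm w)\<^sup>2)"

definition \<eta>\<^sub>2 :: "real^'n^'m \<Rightarrow> nat \<Rightarrow> real^'q \<Rightarrow> real^'p \<Rightarrow> real" where
  "\<eta>\<^sub>2 X0 k u w = sigma_max A * (I\<alpha> / \<mu>\<^sub>1) * \<eta>\<^sub>1 X0 k u w
     + norm (b + lam k *\<^sub>R u) + 2 * norm (\<A> X0 - b)"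

definition S :: "real^'n^'m \<Rightarrow> nat \<Rightarrow> real^'q \<Rightarrow> real^'p
    \<Rightarrow> ((real^'n^'m) \<times> (real^'p) \<times> (real^'q)) set" where
  "S X0 k u w = {(X, s, y). \<mu>\<^sub>1 * sv_norm \<alpha> X \<le> \<eta>\<^sub>1 X0 k u w \<and> \<mu>\<^sub>2 * vec_norm \<beta> s \<le> \<eta>\<^sub>1 X0 k u w}"

definition lmax :: "real^'n^'m \<Rightarrow> nat \<Rightarrow> real^'q \<Rightarrow> real^'p
    \<Rightarrow> (real^'n^'m) \<times> (real^'p) \<times> (real^'q) \<Rightarrow> real" where
  "lmax X0 k u w = (\<lambda>(X, s, y). sqrt (2 * L / \<epsilon> k) *
     ((I\<alpha> / \<mu>\<^sub>1 + J\<beta> / \<mu>\<^sub>2) * \<eta>\<^sub>1 X0 k u w + \<eta>\<^sub>2 X0 k u w + norm X + norm s + norm y))"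

definition GRADstop :: "nat \<Rightarrow> real^'q \<Rightarrow> real^'p
    \<Rightarrow> (real^'n^'m) \<times> (real^'p) \<times> (real^'q) \<Rightarrow> bool" where
  "GRADstop k u w = (\<lambda>(X, s, y).
     (\<exists>G \<in> {(lam k * \<mu>\<^sub>1) *\<^sub>R H + gradient (\<lambda>X'. f k u w (X', s, y)) X |
               H. H \<in> subdifferential (sv_norm \<alpha>) X}.
      \<exists>g \<in> {(lam k * \<mu>\<^sub>2) *\<^sub>R h + gradient (\<lambda>s'. f k u w (X, s', y)) s |
               h. h \<in> subdifferential (vec_norm \<beta>) s}.
        sqrt ((norm G)\<^sup>2 + (norm g)\<^sup>2) \<le> \<tau> k)
     \<and> norm (y - closest_point Q (y - (1 / L) *\<^sub>R gradient (\<lambda>y'. f k u w (X, s, y')) y)) \<le> \<xi> k)"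

text \<open>\<open>APG X0 k u w z z'\<close>: the inner routine of outer iteration \<open>k\<close>, started at \<open>z\<close>, stops
  after \<open>N\<close> steps and returns \<open>z'\<close>.\<close>

definition APG :: "real^'n^'m \<Rightarrow> nat \<Rightarrow> real^'q \<Rightarrow> real^'p
    \<Rightarrow> (real^'n^'m) \<times> (real^'p) \<times> (real^'q)
    \<Rightarrow> (real^'n^'m) \<times> (real^'p) \<times> (real^'q) \<Rightarrow> bool" where
  "APG X0 k u w z z' \<longleftrightarrow> (\<exists>z\<^sub>1 z\<^sub>2 (t :: nat \<Rightarrow> real) N.
     z\<^sub>1 0 = z \<and> z\<^sub>2 1 = z \<and> t 1 = 1 \<and>
     (\<forall>l\<in>{1..N}.
        is_arg_min
          (\<lambda>v. p k v + inner (gradient (f k u w) (z\<^sub>2 l)) (v - z\<^sub>2 l) + L / 2 * (norm (v - z\<^sub>2 l))\<^sup>2)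
          (\<lambda>v. v \<in> S X0 k u w \<and> snd (snd v) \<in> Q)
          (z\<^sub>1 l) \<and>
        t (l + 1) = (1 + sqrt (1 + 4 * (t l)\<^sup>2)) / 2 \<and>
        z\<^sub>2 (l + 1) = z\<^sub>1 l + ((t l - 1) / t (l + 1)) *\<^sub>R (z\<^sub>1 l - z\<^sub>1 (l - 1))) \<and>
     (\<forall>l<N. \<not> (real l \<ge> lmax X0 k u w z \<or> GRADstop k u w (z\<^sub>1 l))) \<and>
     (real N \<ge> lmax X0 k u w z \<or> GRADstop k u w (z\<^sub>1 N)) \<and>
     z' = z\<^sub>1 N)"

text \<open>\<open>\<theta>\<^sub>1\<close> and \<open>\<theta>\<^sub>2\<close> are indexed from 1, the iterates \<open>(X, s, y)\<close> from 0.\<close>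

definition FALC :: "(nat \<Rightarrow> real^'n^'m) \<Rightarrow> (nat \<Rightarrow> real^'p) \<Rightarrow> (nat \<Rightarrow> real^'q)
    \<Rightarrow> (nat \<Rightarrow> real^'q) \<Rightarrow> (nat \<Rightarrow> real^'p) \<Rightarrow> bool" where
  "FALC X s y \<theta>\<^sub>1 \<theta>\<^sub>2 \<longleftrightarrow>
     \<A> (X 0) - b \<in> Q \<and> y 0 = \<A> (X 0) - b \<and> s 0 = \<C> (X 0) - d \<and>
     \<theta>\<^sub>1 1 = 0 \<and> \<theta>\<^sub>2 1 = 0 \<and>
     (\<forall>k\<ge>1.
        APG (X 0) k (\<theta>\<^sub>1 k) (\<theta>\<^sub>2 k) (X (k - 1), s (k - 1), y (k - 1)) (X k, s k, y k) \<and>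
        \<theta>\<^sub>1 (k + 1) = \<theta>\<^sub>1 k - (1 / lam k) *\<^sub>R (\<A> (X k) - y k - b) \<and>
        \<theta>\<^sub>2 (k + 1) = \<theta>\<^sub>2 k - (1 / lam k) *\<^sub>R (\<C> (X k) - s k - d))"

end

end

theory Submission
  imports Defs
begin

text \<open>Every outer iterate is an approximate minimizer of its subproblem, whichever stopping rule
  fired. If the iteration bound fired, this is the \<open>O(1/l\<^sup>2)\<close> rate of the accelerated proximal
  gradient method; the bound is large enough because a minimizer of the subproblem exists within
  an explicit radius and inside the constraint set. If the gradient rule fired, it follows from
  convexity. Since the residuals of the subproblem are \<open>- lam k\<close> times the new multipliers,
  comparing the iterate with points of smaller residual bounds the multipliers uniformly
  (surjectivity of \<open>\<A>\<close> enters here). Hence \<open>\<A> X - b - y\<close> and \<open>\<C> X - d - s\<close> tend to zero, and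
  comparing the iterate with \<open>(Z, \<C> Z - d, \<A> Z - b)\<close> for feasible \<open>Z\<close>, dividing by \<open>lam k\<close> and passing
  to the limit gives optimality. The norms of singular values are handled through an orthonormal
  basis \<open>v\<close> of eigenvectors of \<open>X\<^sup>TX\<close>, for which the singular values are the numbers
  \<open>norm (X *v v i)\<close>, up to zeros.\<close>

section \<open>Singular values via an orthonormal eigenbasis\<close>

text \<open>The scaling in \<open>lam k\<close> is what makes the multiplier bounds close. A
  residual of the subproblem has norm \<open>lam k * m\<close>, where \<open>m\<close> is the norm
  of the new multiplier. Removing it, or a fixed fraction of it, lowers the quadratic term by order
  \<open>(lam k)^2 * m^2\<close> and raises the other terms by order \<open>(lam k)^2 * m\<close>;
  the inexactness costs \<open>B * (lam k)^2\<close> from \<open>\<epsilon>\<close> and again order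
  \<open>(lam k)^2 * m\<close> from \<open>\<tau>\<close>. Cancelling \<open>(lam k)^2\<close>
  leaves a quadratic inequality in \<open>m\<close> whose coefficients do not depend on
  \<open>k\<close>. These comparisons keep \<open>y k\<close>, so they stay feasible whatever
  \<open>Q\<close> is. The second multiplier is bounded first, because a step in X alters both
  residuals whereas a step in s alters only one.

  The gradient rule gives no uniform gap in the objective: its error grows with the distance to the
  comparison point. In the limit this is harmless, since the iterates converge along the subsequence
  and the comparison point is fixed: the distances are bounded while \<open>\<tau> k / lam k\<close>
  and \<open>\<xi> k / lam k\<close> vanish.\<close>

lemma selfadjoint_eigenvector:
  fixes T :: "'a::euclidean_space \<Rightarrow> 'a"
  assumes "linear T" and sa: "\<And>x y. inner (T x) y = inner x (T y)"
    and "subspace S" and inv: "\<And>x. x \<in> S \<Longrightarrow> T x \<in> S" and ne: "S \<noteq> {0}"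
  obtains v c where "v \<in> S" "norm v = 1" "T v = c *\<^sub>R v"
proof -
  interpret T: linear T by fact
  define K where "K = S \<inter> sphere 0 1"
  have "compact K"
    unfolding K_def using closed_subspace[OF \<open>subspace S\<close>] by (intro closed_Int_compact) auto
  moreover obtain z where z: "z \<in> S" "z \<noteq> 0"
    using ne subspace_0[OF \<open>subspace S\<close>] by blast
  then have "(1 / norm z) *\<^sub>R z \<in> K"
    unfolding K_def using \<open>subspace S\<close> by (auto simp: subspace_scale)
  then have "K \<noteq> {}" by blast
  moreover have "continuous_on K (\<lambda>x. inner x (T x))"
    by (intro continuous_intros linear_continuous_on) (simp add: \<open>linear T\<close> linear_conv_bounded_linear[symmetric])
  ultimately obtain v where v: "v \<in> K" and max: "\<And>x. x \<in> K \<Longrightarrow> inner x (T x) \<le> inner v (T v)"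
    using continuous_attains_sup by metis
  define c where "c = inner v (T v)"
  have nv: "norm v = 1" "inner v v = 1" and vS: "v \<in> S"
    using v by (auto simp: K_def norm_eq_1)
  have ray: "inner w (T w) \<le> c * inner w w" if "w \<in> S" for w
  proof (cases "w = 0")
    case False
    then have "(1 / norm w) *\<^sub>R w \<in> K"
      unfolding K_def using \<open>subspace S\<close> that by (auto simp: subspace_scale)
    from max[OF this] have "inner w (T w) / (norm w)\<^sup>2 \<le> c"
      by (simp add: T.scale c_def power2_eq_square)
    then show ?thesis
      using False by (simp add: divide_le_eq power2_norm_eq_inner)
  qed (simp add: T.zero)
  \<comment> \<open>\<open>v\<close> maximizes the Rayleigh quotient on the unit sphere of
    \<open>S\<close>, with value \<open>c\<close>. The defect \<open>u\<close> is orthogonal to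
    \<open>v\<close>, and a move by \<open>e *\<^sub>R u\<close> would raise the quotient at first
    order in \<open>e\<close> unless \<open>u = 0\<close>.\<close>
  define u where "u = T v - c *\<^sub>R v"
  have uS: "u \<in> S"
    unfolding u_def using vS inv \<open>subspace S\<close> by (auto intro: subspace_diff subspace_scale)
  define k where "k = c * inner u u - inner u (T u)"
  have quad: "2 * inner u u \<le> e * k" if "e > 0" for e
  proof -
    have "v + e *\<^sub>R u \<in> S"
      using vS uS \<open>subspace S\<close> by (auto intro: subspace_add subspace_scale)
    from ray[OF this]
    moreover have "inner (v + e *\<^sub>R u) (T (v + e *\<^sub>R u))
        = c + 2 * e * inner u (T v) + e * e * inner u (T u)"
      using sa[of u v]
      by (simp add: T.add T.scale inner_add_left inner_add_right c_def[symmetric] algebra_simps inner_commute)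
    moreover have "inner (v + e *\<^sub>R u) (v + e *\<^sub>R u) = 1 + 2 * e * inner u v + e * e * inner u u"
      using nv by (simp add: inner_add_left inner_add_right algebra_simps inner_commute)
    ultimately have "c + 2 * e * inner u (T v) + e * e * inner u (T u)
        \<le> c * (1 + 2 * e * inner u v + e * e * inner u u)" by simp
    then have "2 * e * (inner u (T v) - c * inner u v) \<le> e * e * k"
      unfolding k_def by (simp only: algebra_simps)
    moreover have "inner u u = inner u (T v) - c * inner u v"
      by (simp add: u_def inner_diff_right)
    ultimately have "e * (2 * inner u u) \<le> e * (e * k)"
      by (simp only: mult_ac)
    then show ?thesis using that by simp
  qed
  have "inner u u = 0"
  proof (rule ccontr)
    assume *: "inner u u \<noteq> 0"
    then have pos: "inner u u > 0" using inner_ge_zero[of u] by linarith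
    then have "k > 0" using quad[of 1] by linarith
    then show False using quad[of "inner u u / k"] pos by simp
  qed
  then have "T v = c *\<^sub>R v" by (simp add: u_def)
  with vS nv show ?thesis using that by blast
qed

text \<open>Induction on the dimension: split off one eigenvector; self-adjointness makes its
  orthogonal complement in \<open>S\<close> invariant again. The eigenvectors form a set because
  \<open>S\<close> shrinks and offers no index type; they are indexed only once \<open>S\<close> is
  the whole space.\<close>

lemma selfadjoint_orthonormal_eigenset:
  fixes T :: "'a::euclidean_space \<Rightarrow> 'a"
  assumes "linear T" and sa: "\<And>x y. inner (T x) y = inner x (T y)"
    and "subspace S" and "\<And>x. x \<in> S \<Longrightarrow> T x \<in> S"
  shows "\<exists>B \<subseteq> S. finite B \<and> pairwise orthogonal B \<and> card B = dim S
           \<and> (\<forall>v\<in>B. norm v = 1 \<and> (\<exists>c. T v = c *\<^sub>R v))"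
  using assms(3,4)
proof (induction "dim S" arbitrary: S)
  case 0
  then show ?case by (intro exI[of _ "{}"]) auto
next
  case (Suc k)
  then have "S \<noteq> {0}" by auto
  then obtain v c where v: "v \<in> S" "norm v = 1" "T v = c *\<^sub>R v"
    using selfadjoint_eigenvector[OF assms(1,2) Suc.prems] by metis
  define S' where "S' = {y \<in> S. \<forall>x \<in> span {v}. orthogonal x y}"
  have S': "S' = {y \<in> S. orthogonal v y}"
    unfolding S'_def by (auto simp: span_singleton orthogonal_def intro: exI[of _ "1::real"])
  have sub: "subspace S'"
    unfolding S' using Suc.prems(1) by (auto simp: subspace_def orthogonal_def inner_add_right)
  have "span {v} \<subseteq> S"
    using v(1) Suc.prems(1) by (simp add: span_minimal)
  then have "dim S' + dim (span {v}) = dim S"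
    unfolding S'_def by (intro dim_subspace_orthogonal_to_vectors) (auto simp: Suc.prems)
  moreover have "dim (span {v}) = 1"
    using v(2) by (auto simp: dim_span dim_singleton)
  ultimately have dimS': "k = dim S'" using Suc.hyps(2) by simp
  have invS': "T x \<in> S'" if "x \<in> S'" for x
    using that Suc.prems(2) sa[of v x] v(3) by (auto simp: S' orthogonal_def)
  obtain B where B: "B \<subseteq> S'" "finite B" "pairwise orthogonal B" "card B = dim S'"
      "\<forall>v\<in>B. norm v = 1 \<and> (\<exists>c. T v = c *\<^sub>R v)"
    using Suc.hyps(1)[OF dimS' sub invS'] by blast
  have "v \<notin> B"
    using B(1) v(2) unfolding S' by (auto simp: orthogonal_self)
  then have "card (insert v B) = dim S"
    using B(2,4) dimS' Suc.hyps(2) by simp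
  moreover have "pairwise orthogonal (insert v B)"
    using B(1,3) unfolding S' by (auto simp: pairwise_insert orthogonal_commute)
  ultimately show ?case
    using B v unfolding S' by (intro exI[of _ "insert v B"]) auto
qed

section \<open>Orthonormal families, characteristic polynomials and singular frames\<close>

definition orthonormal :: "('i \<Rightarrow> 'a::real_inner) \<Rightarrow> bool" where
  "orthonormal v \<longleftrightarrow> (\<forall>i j. inner (v i) (v j) = (if i = j then 1 else 0))"

text \<open>A family indexed by \<open>'n\<close> fills a square matrix, and for square matrices
  \<open>V ** transpose V = mat 1\<close> can be turned around. The reversed identity expresses
  completeness.\<close>

lemma orthonormal_expansion:
  fixes v :: "'n::finite \<Rightarrow> real^'n"
  assumes "orthonormal v"
  shows "(\<Sum>i\<in>UNIV. inner x (v i) *\<^sub>R v i) = x"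
proof -
  define V where "V = (\<chi> i. v i)"
  have "V ** transpose V = mat 1"
    using assms by (simp add: V_def orthonormal_def vec_eq_iff matrix_matrix_mult_def
        transpose_def mat_def inner_vec_def)
  then have "transpose V ** V = mat 1" using matrix_left_right_inverse by blast
  then have *: "(\<Sum>i\<in>UNIV. v i $ a * v i $ b) = (if a = b then 1 else 0)" for a b
    by (simp add: V_def vec_eq_iff matrix_matrix_mult_def transpose_def mat_def)
  show ?thesis
  proof (subst vec_eq_iff, intro allI)
    fix a
    have "(\<Sum>i\<in>UNIV. inner x (v i) *\<^sub>R v i) $ a = (\<Sum>i\<in>UNIV. \<Sum>b\<in>UNIV. x $ b * (v i $ b * v i $ a))"
      by (simp add: sum_component inner_vec_def sum_distrib_right mult.assoc)
    also have "\<dots> = (\<Sum>b\<in>UNIV. x $ b * (\<Sum>i\<in>UNIV. v i $ b * v i $ a))"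
      by (subst sum.swap) (simp add: sum_distrib_left)
    also have "\<dots> = x $ a" by (simp add: * if_distrib cong: if_cong)
    finally show "(\<Sum>i\<in>UNIV. inner x (v i) *\<^sub>R v i) $ a = x $ a" .
  qed
qed

lemma orthonormal_parseval:
  fixes v :: "'n::finite \<Rightarrow> real^'n"
  assumes "orthonormal v"
  shows "(\<Sum>i\<in>UNIV. (inner x (v i))\<^sup>2) = (norm x)\<^sup>2"
proof -
  have "inner x (\<Sum>i\<in>UNIV. inner x (v i) *\<^sub>R v i) = (\<Sum>i\<in>UNIV. (inner x (v i))\<^sup>2)"
    by (simp add: inner_sum_right power2_eq_square)
  then show ?thesis by (simp add: orthonormal_expansion[OF assms] power2_norm_eq_inner)
qed

text \<open>With the eigenvectors as columns of \<open>V\<close>, the matrix \<open>x I - M\<close>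
  times \<open>V\<close> equals \<open>V\<close> times a diagonal matrix. Over the polynomial ring,
  an integral domain, \<open>det V\<close> cancels because its square is 1.\<close>

lemma charpoly_eq_prod:
  fixes M :: "real^'n^'n" and v :: "'n::finite \<Rightarrow> real^'n"
  assumes on: "orthonormal v" and ev: "\<And>i. M *v v i = c i *\<^sub>R v i"
  shows "charpoly M = (\<Prod>i\<in>UNIV. [:- c i, 1:])"
proof -
  define V :: "real poly^'n^'n" where "V = (\<chi> a i. [:v i $ a:])"
  define N :: "real poly^'n^'n" where
    "N = (\<chi> i j. (if i = j then [:0, 1:] else 0) - [:M $ i $ j:])"
  define D :: "real poly^'n^'n" where "D = (\<chi> i j. if i = j then [:- c i, 1:] else 0)"
  have const_sum: "(\<Sum>x\<in>A. [:g x:]) = [:\<Sum>x\<in>A. g x:]" for A :: "'n set" and g :: "'n \<Rightarrow> real"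
    by (induction A rule: infinite_finite_induct) auto
  have "transpose V ** V = mat 1"
    using on by (simp add: V_def orthonormal_def vec_eq_iff matrix_matrix_mult_def
        transpose_def mat_def inner_vec_def const_sum one_pCons)
  then have "det V * det V = 1"
    by (metis det_I det_mul det_transpose)
  then have V0: "det V \<noteq> 0" by auto
  have Mv: "(\<Sum>k\<in>UNIV. M $ a $ k * v i $ k) = c i * v i $ a" for a i
    using ev[of i] by (simp add: vec_eq_iff matrix_vector_mult_def)
  have "N ** V = V ** D"
  proof (subst vec_eq_iff, intro allI, subst vec_eq_iff, intro allI)
    fix a i
    have "(N ** V) $ a $ i = (\<Sum>k\<in>UNIV. (if a = k then [:0, 1:] else 0) * [:v i $ k:]) - (\<Sum>k\<in>UNIV. [:M $ a $ k:] * [:v i $ k:])"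
      unfolding matrix_matrix_mult_def N_def V_def
      by (simp only: vec_lambda_beta left_diff_distrib sum_subtractf)
    also have "\<dots> = [:0, 1:] * [:v i $ a:] - [:c i * v i $ a:]"
      by (simp add: const_sum Mv[unfolded mult.commute[of "M $ _ $ _"]] if_distrib[of "smult _"] cong: if_cong)
    also have "\<dots> = (V ** D) $ a $ i"
      by (simp add: matrix_matrix_mult_def D_def V_def if_distrib[of "\<lambda>x. _ * x"] cong: if_cong)
    finally show "(N ** V) $ a $ i = (V ** D) $ a $ i" .
  qed
  then have "det N * det V = det V * det D" by (metis det_mul)
  then have "det N = det D" using V0 by simp
  also have "det D = (\<Prod>i\<in>UNIV. [:- c i, 1:])"
    by (subst det_diagonal) (auto simp: D_def)
  finally show ?thesis by (simp add: charpoly_def N_def)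
qed

text \<open>An orthonormal system of right singular vectors. Writing the eigenvalue as a squared
  norm makes the numbers \<open>norm (X *v v i)\<close> the singular values, unordered and always
  \<open>CARD('n)\<close> of them.\<close>

definition singular_frame :: "real^'n^'m \<Rightarrow> ('n \<Rightarrow> real^'n) \<Rightarrow> bool" where
  "singular_frame X v \<longleftrightarrow> orthonormal v \<and>
     (\<forall>i. transpose X *v (X *v v i) = (norm (X *v v i))\<^sup>2 *\<^sub>R v i)"

lemma inner_matrix_vector_transpose:
  fixes X :: "real^'n^'m"
  shows "inner (X *v x) y = inner x (transpose X *v y)"
  by (metis dot_lmul_matrix vector_transpose_matrix inner_commute transpose_transpose)

lemma ex_singular_frame:
  fixes X :: "real^'n^'m"
  obtains v where "singular_frame X v"
proof -
  define T where "T x = transpose X *v (X *v x)" for x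
  have "linear T"
    unfolding T_def
    by (rule linear_compose[OF matrix_vector_mul_linear matrix_vector_mul_linear, unfolded comp_def])
  moreover have T: "inner (T x) y = inner (X *v x) (X *v y)" for x y
    unfolding T_def by (metis inner_commute inner_matrix_vector_transpose)
  then have "inner (T x) y = inner x (T y)" for x y
    by (metis inner_commute)
  ultimately obtain B :: "(real^'n) set" where B: "finite B" "pairwise orthogonal B" "card B = dim (UNIV :: (real^'n) set)"
      "\<And>v. v\<in>B \<Longrightarrow> norm v = 1 \<and> (\<exists>c. T v = c *\<^sub>R v)"
    using selfadjoint_orthonormal_eigenset[of T UNIV] by auto
  then obtain v where v: "bij_betw v (UNIV :: 'n set) B"
    using finite_same_card_bij[of "UNIV :: 'n set" B] by (auto simp: dim_UNIV)
  then have vB: "v i \<in> B" for i by (auto simp: bij_betw_def)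
  have inj: "i = j" if "v i = v j" for i j
    using v that by (auto simp: bij_betw_def inj_on_def)
  have "inner (v i) (v j) = 0" if "i \<noteq> j" for i j
    using that inj[of i j] B(2) vB unfolding pairwise_def orthogonal_def by blast
  moreover have "inner (v i) (v i) = 1" for i
    using B(4)[OF vB] by (simp add: norm_eq_1)
  ultimately have "orthonormal v"
    unfolding orthonormal_def by simp
  moreover have "transpose X *v (X *v v i) = (norm (X *v v i))\<^sup>2 *\<^sub>R v i" for i
  proof -
    obtain c where c: "T (v i) = c *\<^sub>R v i" using B(4)[OF vB] by blast
    have "inner (T (v i)) (v i) = c"
      using \<open>orthonormal v\<close> by (simp add: c orthonormal_def)
    then have "c = (norm (X *v v i))\<^sup>2" by (simp add: T power2_norm_eq_inner)
    with c show ?thesis by (simp add: T_def)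
  qed
  ultimately show ?thesis using that by (auto simp: singular_frame_def)
qed

lemma singular_frame_orthogonal:
  assumes "singular_frame X v" "i \<noteq> j"
  shows "inner (X *v v i) (X *v v j) = 0"
  using assms by (simp add: singular_frame_def inner_matrix_vector_transpose orthonormal_def)

text \<open>The nonzero images are pairwise orthogonal, hence independent in a space of dimension
  \<open>CARD('m)\<close>. This is why truncating the list of singular values loses only
  zeros.\<close>

lemma card_singular_frame_nonzero:
  fixes X :: "real^'n^'m"
  assumes "singular_frame X v"
  shows "card {i. X *v v i \<noteq> 0} \<le> min CARD('m) CARD('n)"
proof -
  let ?I = "{i. X *v v i \<noteq> 0}"
  \<comment> \<open>Independence counts distinct images; injectivity turns this into a count of
    indices.\<close>
  have inj: "inj_on (\<lambda>i. X *v v i) ?I"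
  proof (rule inj_onI)
    fix i j assume "i \<in> ?I" and eq: "X *v v i = X *v v j"
    then have "inner (X *v v i) (X *v v j) \<noteq> 0" by simp
    then show "i = j" using singular_frame_orthogonal[OF assms] by blast
  qed
  have "pairwise orthogonal ((\<lambda>i. X *v v i) ` ?I)"
  proof (clarsimp simp: pairwise_image pairwise_def)
    fix i j assume "X *v v i \<noteq> X *v v j"
    then have "i \<noteq> j" by blast
    then show "orthogonal (X *v v i) (X *v v j)"
      using singular_frame_orthogonal[OF assms] by (simp add: orthogonal_def)
  qed
  then have "independent ((\<lambda>i. X *v v i) ` ?I)"
    by (intro pairwise_orthogonal_independent) auto
  then have "card ((\<lambda>i. X *v v i) ` ?I) \<le> CARD('m)"
    using independent_bound by fastforce
  moreover have "card ?I \<le> CARD('n)" by (intro card_mono) auto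
  ultimately show ?thesis by (simp add: card_image[OF inj])
qed

text \<open>Every retained entry is at least as large as a discarded one. A positive discarded entry
  would therefore give, with the \<open>r\<close> retained ones, more than \<open>r\<close> nonzero
  entries.\<close>

lemma drop_sorted_wrt_ge_eq_0:
  fixes xs :: "real list"
  assumes "sorted_wrt (\<ge>) xs" and nn: "\<And>x. x \<in> set xs \<Longrightarrow> 0 \<le> x"
    and few: "length (filter (\<lambda>x. x \<noteq> 0) xs) \<le> r" and "x \<in> set (drop r xs)"
  shows "x = 0"
proof (rule ccontr)
  assume "x \<noteq> 0"
  then have "x > 0" using nn assms(4) by (metis in_set_dropD less_eq_real_def)
  have "y \<noteq> 0" if "y \<in> set (take r xs)" for y
    using assms(1) that assms(4) \<open>x > 0\<close>
    by (metis append_take_drop_id leD sorted_wrt_append)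
  then have "filter (\<lambda>x. x \<noteq> 0) (take r xs) = take r xs" by simp
  moreover have "filter (\<lambda>x. x \<noteq> 0) (drop r xs) \<noteq> []"
    using assms(4) \<open>x \<noteq> 0\<close> by (auto simp: filter_empty_conv)
  moreover have "filter (\<lambda>x. x \<noteq> 0) xs = filter (\<lambda>x. x \<noteq> 0) (take r xs) @ filter (\<lambda>x. x \<noteq> 0) (drop r xs)"
    by (metis append_take_drop_id filter_append)
  moreover have "r < length xs" using assms(4) by (metis drop_eq_Nil empty_iff linorder_not_le list.set(1))
  ultimately show False using few by simp
qed

text \<open>A frame has \<open>CARD('n)\<close> vectors but the list is cut to the smaller
  dimension, so zeros are added to make the multisets agree. Later facts on singular values rest on
  this equality and the length, not on the order of the list.\<close>

lemma mset_singular_values: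
  fixes X :: "real^'n^'m"
  assumes "singular_frame X v"
  shows "mset (singular_values X) + replicate_mset (CARD('n) - min CARD('m) CARD('n)) 0
           = image_mset (\<lambda>i. norm (X *v v i)) (mset_set UNIV)"
    and "length (singular_values X) = min CARD('m) CARD('n)"
proof -
  let ?r = "min CARD('m) CARD('n)"
  define xs where "xs = rev (sorted_list_of_multiset (image_mset (\<lambda>i. norm (X *v v i)) (mset_set UNIV)))"
  have "(transpose X ** X) *v v i = (norm (X *v v i))\<^sup>2 *\<^sub>R v i" for i
    using assms by (simp add: singular_frame_def matrix_vector_mul_assoc[symmetric])
  then have "charpoly (transpose X ** X) = (\<Prod>i\<in>UNIV. [:- ((norm (X *v v i))\<^sup>2), 1:])"
    using assms by (intro charpoly_eq_prod) (auto simp: singular_frame_def)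
  then have "proots (charpoly (transpose X ** X)) = (\<Sum>i\<in>UNIV. {#(norm (X *v v i))\<^sup>2#})"
    by (simp add: proots_prod)
  also have "\<dots> = image_mset (\<lambda>i. (norm (X *v v i))\<^sup>2) (mset_set UNIV)"
    by (simp add: sum_unfold_sum_mset)
  finally have sv: "singular_values X = take ?r xs"
    by (simp add: singular_values_def xs_def multiset.map_comp comp_def)
  have mset_xs: "mset xs = image_mset (\<lambda>i. norm (X *v v i)) (mset_set UNIV)"
    by (simp add: xs_def)
  have len: "length xs = CARD('n)" by (metis mset_xs size_mset size_image_mset size_mset_set)
  have "length (filter (\<lambda>x. x \<noteq> 0) xs) = size (filter_mset (\<lambda>x. x \<noteq> 0) (mset xs))"
    by (metis mset_filter size_mset)
  also have "\<dots> = card {i. X *v v i \<noteq> 0}"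
    by (simp add: mset_xs filter_mset_image_mset)
  finally have few: "length (filter (\<lambda>x. x \<noteq> 0) xs) \<le> ?r"
    using card_singular_frame_nonzero[OF assms] by simp
  have "sorted_wrt (\<ge>) xs"
    by (simp add: xs_def sorted_wrt_rev)
  moreover have "0 \<le> x" if "x \<in> set xs" for x
  proof -
    have "x \<in># mset xs" using that by simp
    then show ?thesis unfolding mset_xs by auto
  qed
  ultimately have "\<forall>x \<in> set (drop ?r xs). x = 0"
    using drop_sorted_wrt_ge_eq_0 few by blast
  then have "drop ?r xs = replicate (CARD('n) - ?r) 0"
    by (intro replicate_eqI) (auto simp: len)
  then have "mset (drop ?r xs) = replicate_mset (CARD('n) - ?r) 0" by simp
  then show "mset (singular_values X) + replicate_mset (CARD('n) - ?r) 0
           = image_mset (\<lambda>i. norm (X *v v i)) (mset_set UNIV)"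
    by (metis sv mset_xs append_take_drop_id mset_append)
  show "length (singular_values X) = ?r" by (simp add: sv len)
qed

section \<open>The singular value and vector norms\<close>

lemma singular_values_nonneg:
  assumes "x \<in> set (singular_values X)"
  shows "0 \<le> x"
proof -
  obtain v where v: "singular_frame X v" using ex_singular_frame by blast
  have "x \<in># mset (singular_values X) + replicate_mset n 0" for n
    using assms by simp
  then have "x \<in># image_mset (\<lambda>i. norm (X *v v i)) (mset_set UNIV)"
    by (metis mset_singular_values(1)[OF v])
  then show ?thesis by auto
qed

text \<open>The condition \<open>g 0 = 0\<close> hides the zeros by which the frame exceeds the
  list.\<close>

lemma sum_singular_values:
  fixes X :: "real^'n^'m"
  assumes "singular_frame X v" and "g 0 = (0::real)"
  shows "(\<Sum>i<min CARD('m) CARD('n). g (singular_values X ! i)) = (\<Sum>i\<in>UNIV. g (norm (X *v v i)))"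
proof -
  have "sum_mset (image_mset g (mset (singular_values X) + replicate_mset (CARD('n) - min CARD('m) CARD('n)) 0))
      = (\<Sum>i\<in>UNIV. g (norm (X *v v i)))"
    unfolding mset_singular_values(1)[OF assms(1)]
    by (simp add: multiset.map_comp comp_def sum_unfold_sum_mset)
  moreover have "sum_mset (image_mset g (mset (singular_values X))) = sum_list (map g (singular_values X))"
    by (metis mset_map sum_mset_sum_list)
  ultimately show ?thesis
    by (simp add: sum_list_sum_nth mset_singular_values(2)[OF assms(1)] assms(2) lessThan_atLeast0)
qed

lemma Max_singular_values:
  fixes X :: "real^'n^'m"
  assumes v: "singular_frame X v"
  shows "Max (set (singular_values X)) = Max (range (\<lambda>i. norm (X *v v i)))"
    and "set (singular_values X) \<noteq> {}"
proof -
  have mset: "mset (singular_values X) + replicate_mset (CARD('n) - min CARD('m) CARD('n)) 0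
           = image_mset (\<lambda>i. norm (X *v v i)) (mset_set UNIV)"
    by (rule mset_singular_values(1)[OF v])
  have "length (singular_values X) \<noteq> 0"
    by (simp add: mset_singular_values(2)[OF v])
  then show ne: "set (singular_values X) \<noteq> {}" by auto
  \<comment> \<open>A frame norm may be one of the padding zeros; it is then dominated by any
    singular value, since these are nonnegative and at least one exists.\<close>
  have "\<exists>a \<in> set (singular_values X). norm (X *v v i) \<le> a" for i
  proof -
    have "norm (X *v v i) \<in># mset (singular_values X) + replicate_mset (CARD('n) - min CARD('m) CARD('n)) 0"
      unfolding mset by simp
    then have "norm (X *v v i) \<in> set (singular_values X) \<or> norm (X *v v i) = 0"
      by (auto split: if_splits)
    moreover obtain b where b: "b \<in> set (singular_values X)" using ne by (meson ex_in_conv)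
    ultimately show ?thesis using singular_values_nonneg[OF b] by auto
  qed
  moreover have "x \<in> range (\<lambda>i. norm (X *v v i))" if "x \<in> set (singular_values X)" for x
  proof -
    have "x \<in># mset (singular_values X) + replicate_mset (CARD('n) - min CARD('m) CARD('n)) 0"
      using that by simp
    then show ?thesis unfolding mset by simp
  qed
  ultimately show "Max (set (singular_values X)) = Max (range (\<lambda>i. norm (X *v v i)))"
    using ne by (intro antisym Max.boundedI[of "range _"] Max_mono) (auto simp: Max_ge_iff)
qed

text \<open>Parseval applied to each row of \<open>X\<close>, after exchanging the two sums.\<close>

lemma sum_norm_singular_frame_power2:
  fixes X :: "real^'n^'m" and v :: "'n \<Rightarrow> real^'n"
  assumes "orthonormal v"
  shows "(\<Sum>i\<in>UNIV. (norm (X *v v i))\<^sup>2) = (norm X)\<^sup>2"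
proof -
  have "(\<Sum>i\<in>UNIV. (norm (X *v v i))\<^sup>2) = (\<Sum>i\<in>UNIV. \<Sum>a\<in>UNIV. (inner (X $ a) (v i))\<^sup>2)"
    by (simp add: norm_vec_def L2_set_def sum_nonneg matrix_vector_mul_component)
  also have "\<dots> = (\<Sum>a\<in>UNIV. (norm (X $ a))\<^sup>2)"
    by (subst sum.swap) (simp add: orthonormal_parseval[OF assms])
  also have "\<dots> = (norm X)\<^sup>2"
    by (subst (2) norm_vec_def) (simp add: L2_set_def sum_nonneg)
  finally show ?thesis .
qed

lemma norm_mult_le_Max_singular_frame:
  fixes X :: "real^'n^'m"
  assumes "singular_frame X v"
  shows "norm (X *v x) \<le> Max (range (\<lambda>i. norm (X *v v i))) * norm x"
proof -
  let ?K = "Max (range (\<lambda>i. norm (X *v v i)))"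
  have on: "orthonormal v" using assms by (simp add: singular_frame_def)
  have K: "norm (X *v v i) \<le> ?K" for i by simp
  have K0: "0 \<le> ?K" using K norm_ge_zero order_trans by blast
  have "inner (transpose X *v (X *v x)) (v i) = (norm (X *v v i))\<^sup>2 * inner x (v i)" for i
  proof -
    have "inner (transpose X *v (X *v x)) (v i) = inner x (transpose X *v (X *v v i))"
      by (metis inner_commute inner_matrix_vector_transpose)
    then show ?thesis using assms by (simp add: singular_frame_def)
  qed
  \<comment> \<open>The product of the transpose with \<open>X\<close> is diagonal in the frame,
    which turns the squared norm of \<open>X *v x\<close> into a weighted Parseval sum.\<close>
  then have "inner x (transpose X *v (X *v x)) = (\<Sum>i\<in>UNIV. inner x (v i) * ((norm (X *v v i))\<^sup>2 * inner x (v i)))"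
    by (subst (2) orthonormal_expansion[OF on, symmetric])
      (simp add: inner_sum_right mult_ac)
  then have "(norm (X *v x))\<^sup>2 = (\<Sum>i\<in>UNIV. (norm (X *v v i))\<^sup>2 * (inner x (v i))\<^sup>2)"
    by (simp only: power2_norm_eq_inner[of "X *v x"] inner_matrix_vector_transpose)
      (simp add: power2_eq_square mult_ac)
  also have "\<dots> \<le> (\<Sum>i\<in>UNIV. ?K\<^sup>2 * (inner x (v i))\<^sup>2)"
    by (intro sum_mono mult_right_mono power_mono K) auto
  also have "\<dots> = (?K * norm x)\<^sup>2"
    by (simp add: sum_distrib_left[symmetric] orthonormal_parseval[OF on] power_mult_distrib)
  finally show ?thesis by (rule power2_le_imp_le) (simp add: K0)
qed

lemma norm_le_sigma_max_mult: "norm (X *v x) \<le> sigma_max X * norm x"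
proof -
  obtain v where v: "singular_frame X v" using ex_singular_frame by blast
  show ?thesis
    using norm_mult_le_Max_singular_frame[OF v] by (simp add: sigma_max_def Max_singular_values[OF v])
qed

lemma sigma_max_nonneg: "0 \<le> sigma_max X"
proof -
  obtain v where v: "singular_frame X v" using ex_singular_frame by blast
  have "Max (set (singular_values X)) \<in> set (singular_values X)"
    using Max_singular_values(2)[OF v] by simp
  then show ?thesis unfolding sigma_max_def by (rule singular_values_nonneg)
qed

section \<open>The singular value norms for the three exponents\<close>

lemma lp_norm_2: "lp_norm 2 I v = sqrt (\<Sum>i\<in>I. (v i)\<^sup>2)"
proof -
  have two: "(2::enat) = enat 2" by (simp add: numeral_eq_enat)
  show ?thesis unfolding lp_norm_def two enat.case sqrt_def by simp
qed

lemma sv_norm_1: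
  assumes "singular_frame X v"
  shows "sv_norm 1 X = (\<Sum>i\<in>UNIV. norm (X *v v i))"
proof -
  have "root 1 x = x" for x :: real by simp
  then show ?thesis
    using sum_singular_values[OF assms, of abs]
    by (simp add: sv_norm_def lp_norm_def one_enat_def)
qed

lemma sv_norm_2: "sv_norm 2 X = norm X"
proof -
  obtain v where v: "singular_frame X v" using ex_singular_frame by blast
  then have "orthonormal v" by (simp add: singular_frame_def)
  show ?thesis
    using sum_singular_values[OF v, of "\<lambda>x. x\<^sup>2"] sum_norm_singular_frame_power2[OF \<open>orthonormal v\<close>, of X]
    by (simp add: sv_norm_def lp_norm_2)
qed

lemma sv_norm_inf_eq_sigma_max:
  "sv_norm \<infinity> (X :: real^'n^'m) = sigma_max X"
proof -
  obtain v where v: "singular_frame X v" using ex_singular_frame by blast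
  have "(\<lambda>i. \<bar>singular_values X ! i\<bar>) ` {..<min CARD('m) CARD('n)} = set (singular_values X)"
    using singular_values_nonneg[of _ X] mset_singular_values(2)[OF v]
    by (force simp: set_conv_nth)
  then show ?thesis by (simp add: sv_norm_def lp_norm_def sigma_max_def)
qed

lemma sv_norm_inf:
  assumes "singular_frame X v"
  shows "sv_norm \<infinity> X = Max (range (\<lambda>i. norm (X *v v i)))"
  by (simp add: sv_norm_inf_eq_sigma_max sigma_max_def Max_singular_values(1)[OF assms])

text \<open>One half of the duality between the nuclear and the operator norm: the sum pairs
  \<open>X\<close> with a contraction built from \<open>u\<close> and \<open>v\<close>. Expanding
  each \<open>v i\<close> in a singular frame \<open>w\<close> of \<open>X\<close> and applying
  Cauchy-Schwarz for each \<open>w j\<close>, Parseval makes the first factor 1 and the Bessel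
  hypothesis bounds the second by \<open>norm (X *v w j)\<close>.\<close>

lemma sum_inner_le_sv_norm_1:
  fixes X :: "real^'n^'m" and v :: "'n \<Rightarrow> real^'n"
  assumes v: "orthonormal v"
    and u: "\<And>x :: real^'m. (\<Sum>i\<in>UNIV. (inner (u i) x)\<^sup>2) \<le> (norm x)\<^sup>2"
  shows "(\<Sum>i\<in>UNIV. inner (u i) (X *v v i)) \<le> sv_norm 1 X"
proof -
  obtain w where w: "singular_frame X w" using ex_singular_frame by blast
  then have on: "orthonormal w" by (simp add: singular_frame_def)
  have "X *v v i = (\<Sum>j\<in>UNIV. inner (v i) (w j) *\<^sub>R (X *v w j))" for i
    by (subst orthonormal_expansion[OF on, of "v i", symmetric])
      (simp add: linear_sum[OF matrix_vector_mul_linear] matrix_vector_mult_scaleR)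
  then have "(\<Sum>i\<in>UNIV. inner (u i) (X *v v i))
      = (\<Sum>i\<in>UNIV. \<Sum>j\<in>UNIV. inner (v i) (w j) * inner (u i) (X *v w j))"
    by (simp add: inner_sum_right)
  also have "\<dots> = (\<Sum>j\<in>UNIV. \<Sum>i\<in>UNIV. inner (w j) (v i) * inner (u i) (X *v w j))"
    by (subst sum.swap) (simp add: inner_commute)
  also have "\<dots> \<le> (\<Sum>j\<in>UNIV. norm (X *v w j))"
  proof (rule sum_mono)
    fix j
    have "(\<Sum>i\<in>UNIV. inner (w j) (v i) * inner (u i) (X *v w j))
        \<le> L2_set (\<lambda>i. inner (w j) (v i)) UNIV * L2_set (\<lambda>i. inner (u i) (X *v w j)) UNIV"
      by (rule order_trans[OF sum_mono L2_set_mult_ineq]) (metis abs_ge_self abs_mult)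
    also have "L2_set (\<lambda>i. inner (w j) (v i)) UNIV = norm (w j)"
      by (simp add: L2_set_def orthonormal_parseval[OF v])
    also have "norm (w j) = 1" using on by (simp add: orthonormal_def norm_eq_1)
    also have "L2_set (\<lambda>i. inner (u i) (X *v w j)) UNIV \<le> norm (X *v w j)"
      unfolding L2_set_def using u by (intro real_le_lsqrt) (auto intro: sum_nonneg)
    finally show "(\<Sum>i\<in>UNIV. inner (w j) (v i) * inner (u i) (X *v w j)) \<le> norm (X *v w j)" by simp
  qed
  finally show ?thesis by (simp add: sv_norm_1[OF w])
qed

text \<open>Norms up to 1 are allowed because the application includes zero vectors. The sum equals
  \<open>inner x y\<close> for the partial expansion \<open>y\<close>; there
  \<open>inner y y\<close> is at most \<open>inner x y\<close>, and expanding the square of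
  \<open>x - y\<close> gives the bound.\<close>

lemma bessel_ineq:
  fixes u :: "'i::finite \<Rightarrow> 'a::real_inner"
  assumes orth: "\<And>i j. i \<noteq> j \<Longrightarrow> inner (u i) (u j) = 0" and le: "\<And>i. norm (u i) \<le> 1"
  shows "(\<Sum>i\<in>UNIV. (inner (u i) x)\<^sup>2) \<le> (norm x)\<^sup>2"
proof -
  define y where "y = (\<Sum>i\<in>UNIV. inner (u i) x *\<^sub>R u i)"
  have xy: "inner x y = (\<Sum>i\<in>UNIV. (inner (u i) x)\<^sup>2)"
    by (simp add: y_def inner_sum_right power2_eq_square inner_commute)
  have "inner (u i) y = inner (u i) x * (norm (u i))\<^sup>2" for i
  proof -
    have "inner (u i) y = (\<Sum>j\<in>UNIV. if j = i then inner (u i) x * (norm (u i))\<^sup>2 else 0)"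
      unfolding y_def inner_sum_right
      by (intro sum.cong) (auto simp: orth power2_norm_eq_inner)
    then show ?thesis by simp
  qed
  then have "inner y y = (\<Sum>i\<in>UNIV. (inner (u i) x)\<^sup>2 * (norm (u i))\<^sup>2)"
    by (subst y_def) (simp add: inner_sum_left power2_eq_square mult_ac)
  also have "\<dots> \<le> (\<Sum>i\<in>UNIV. (inner (u i) x)\<^sup>2 * 1)"
    using le by (intro sum_mono mult_left_mono) (auto simp: power_le_one)
  finally have "inner y y \<le> inner x y" by (simp add: xy)
  moreover have "0 \<le> inner (x - y) (x - y)" by simp
  ultimately show ?thesis
    unfolding xy[symmetric] power2_norm_eq_inner
    by (simp add: inner_diff_left inner_diff_right inner_commute)
qed

text \<open>In a frame of \<open>X + Y\<close>, with \<open>u i\<close> the normalized image of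
  \<open>v i\<close> (zero if the image is zero), the pairing of
  \<open>sum_inner_le_sv_norm_1\<close> attains the norm of \<open>X + Y\<close>. It is linear in
  the matrix, so it splits into two parts to which that bound applies.\<close>

lemma sv_norm_1_triangle: "sv_norm 1 (X + Y) \<le> sv_norm 1 X + sv_norm 1 (Y :: real^'n^'m)"
proof -
  obtain v where v: "singular_frame (X + Y) v" using ex_singular_frame by blast
  then have on: "orthonormal v" by (simp add: singular_frame_def)
  define u where "u i = sgn ((X + Y) *v v i)" for i
  have bessel: "(\<Sum>i\<in>UNIV. (inner (u i) x)\<^sup>2) \<le> (norm x)\<^sup>2" for x
  proof (rule bessel_ineq)
    show "inner (u i) (u j) = 0" if "i \<noteq> j" for i j
      using singular_frame_orthogonal[OF v that] by (simp add: u_def sgn_div_norm)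
    show "norm (u i) \<le> 1" for i
      by (simp add: u_def norm_sgn)
  qed
  have "sv_norm 1 (X + Y) = (\<Sum>i\<in>UNIV. inner (u i) ((X + Y) *v v i))"
    unfolding sv_norm_1[OF v] u_def
  proof (rule sum.cong)
    fix i
    show "norm ((X + Y) *v v i) = inner (sgn ((X + Y) *v v i)) ((X + Y) *v v i)"
      by (cases "(X + Y) *v v i = 0")
        (simp_all add: sgn_div_norm power2_norm_eq_inner[symmetric] power2_eq_square)
  qed simp
  also have "\<dots> = (\<Sum>i\<in>UNIV. inner (u i) (X *v v i)) + (\<Sum>i\<in>UNIV. inner (u i) (Y *v v i))"
    by (simp add: matrix_vector_mult_add_rdistrib inner_add_right sum.distrib)
  also have "\<dots> \<le> sv_norm 1 X + sv_norm 1 Y"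
    by (intro add_mono sum_inner_le_sv_norm_1 on bessel)
  finally show ?thesis .
qed

lemma sv_norm_inf_triangle: "sv_norm \<infinity> (X + Y) \<le> sv_norm \<infinity> X + sv_norm \<infinity> (Y :: real^'n^'m)"
proof -
  obtain v where v: "singular_frame (X + Y) v" using ex_singular_frame by blast
  then have nv: "norm (v i) = 1" for i by (simp add: singular_frame_def orthonormal_def norm_eq_1)
  have "norm ((X + Y) *v v i) \<le> sv_norm \<infinity> X + sv_norm \<infinity> Y" for i
  proof -
    have "norm ((X + Y) *v v i) \<le> norm (X *v v i) + norm (Y *v v i)"
      by (simp add: matrix_vector_mult_add_rdistrib norm_triangle_ineq)
    then show ?thesis
      using norm_le_sigma_max_mult[of X "v i"] norm_le_sigma_max_mult[of Y "v i"]
      by (simp add: sv_norm_inf_eq_sigma_max nv)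
  qed
  then show ?thesis unfolding sv_norm_inf[OF v] by (intro Max.boundedI) auto
qed

lemma singular_frame_scaleR:
  assumes "singular_frame X v"
  shows "singular_frame (a *\<^sub>R X) v"
proof -
  have "transpose (a *\<^sub>R X) *v x = a *\<^sub>R (transpose X *v x)" for x
    by (metis scaleR_matrix_vector_assoc transpose_scalar scalar_mult_eq_scaleR)
  then show ?thesis
    using assms by (simp add: singular_frame_def scaleR_matrix_vector_assoc[symmetric]
        matrix_vector_mult_scaleR power2_eq_square power_mult_distrib mult_ac del: transpose_matrix_vector)
qed

lemma sv_norm_scaleR:
  assumes "\<alpha> \<in> {1, 2, \<infinity>}"
  shows "sv_norm \<alpha> (a *\<^sub>R X) = \<bar>a\<bar> * sv_norm \<alpha> X"
proof -
  obtain v where v: "singular_frame X v" using ex_singular_frame by blast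
  note av = singular_frame_scaleR[OF v, of a]
  have "Max (range (\<lambda>i. \<bar>a\<bar> * norm (X *v v i))) = \<bar>a\<bar> * Max (range (\<lambda>i. norm (X *v v i)))"
    using mono_Max_commute[of "\<lambda>x. \<bar>a\<bar> * x" "range (\<lambda>i. norm (X *v v i))"]
    by (simp add: mono_def mult_left_mono image_image)
  then show ?thesis
    using assms by (auto simp: sv_norm_2 sv_norm_1[OF v] sv_norm_1[OF av] sv_norm_inf[OF v] sv_norm_inf[OF av]
        scaleR_matrix_vector_assoc[symmetric] sum_distrib_left)
qed

lemma sv_norm_triangle:
  assumes "\<alpha> \<in> {1, 2, \<infinity>}"
  shows "sv_norm \<alpha> (X + Y) \<le> sv_norm \<alpha> X + sv_norm \<alpha> Y"
  using assms sv_norm_1_triangle sv_norm_inf_triangle by (auto simp: sv_norm_2 norm_triangle_ineq)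

lemma norm_le_sv_norm:
  fixes X :: "real^'n^'m"
  assumes "\<alpha> \<in> {1, 2, \<infinity>}"
  shows "norm X \<le> (if \<alpha> = \<infinity> then sqrt (real (min CARD('m) CARD('n))) else 1) * sv_norm \<alpha> X"
proof -
  obtain v where v: "singular_frame X v" using ex_singular_frame by blast
  then have on: "orthonormal v" by (simp add: singular_frame_def)
  have "norm X = L2_set (\<lambda>i. norm (X *v v i)) UNIV"
    using sum_norm_singular_frame_power2[OF on, of X] by (simp add: L2_set_def)
  then have 1: "norm X \<le> sv_norm 1 X"
    unfolding sv_norm_1[OF v] using L2_set_le_sum[of UNIV "\<lambda>i. norm (X *v v i)"] by simp
  \<comment> \<open>The sum runs over the truncated list, not over the frame: this gives the factor
    \<open>min CARD('m) CARD('n)\<close> in place of \<open>CARD('n)\<close>.\<close>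
  have "(norm X)\<^sup>2 = (\<Sum>i<min CARD('m) CARD('n). (singular_values X ! i)\<^sup>2)"
    using sum_singular_values[OF v, of "\<lambda>x. x\<^sup>2"] sum_norm_singular_frame_power2[OF on, of X] by simp
  also have "\<dots> \<le> (\<Sum>i<min CARD('m) CARD('n). (sigma_max X)\<^sup>2)"
  proof (intro sum_mono power_mono)
    fix i assume "i \<in> {..<min CARD('m) CARD('n)}"
    then have "singular_values X ! i \<in> set (singular_values X)"
      by (simp add: mset_singular_values(2)[OF v])
    then show "singular_values X ! i \<le> sigma_max X" "0 \<le> singular_values X ! i"
      by (auto simp: sigma_max_def intro: singular_values_nonneg)
  qed
  also have "\<dots> = (sqrt (real (min CARD('m) CARD('n))) * sigma_max X)\<^sup>2"
    by (simp add: power_mult_distrib)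
  finally have "norm X \<le> sqrt (real (min CARD('m) CARD('n))) * sv_norm \<infinity> X"
    unfolding sv_norm_inf_eq_sigma_max
    by (rule power2_le_imp_le) (simp add: sigma_max_nonneg)
  with 1 show ?thesis using assms by (auto simp: sv_norm_2)
qed

text \<open>One crude constant for all three exponents: it enters only the bound on the multipliers
  and just has to be independent of \<open>X\<close>.\<close>

lemma sv_norm_le_norm:
  fixes X :: "real^'n^'m"
  assumes "\<alpha> \<in> {1, 2, \<infinity>}"
  shows "sv_norm \<alpha> X \<le> real CARD('n) * norm X"
proof -
  obtain v where v: "singular_frame X v" using ex_singular_frame by blast
  then have on: "orthonormal v" by (simp add: singular_frame_def)
  have le: "norm (X *v v i) \<le> norm X" for i
  proof (rule power2_le_imp_le)
    have "(norm (X *v v i))\<^sup>2 \<le> (\<Sum>i\<in>UNIV. (norm (X *v v i))\<^sup>2)"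
      by (intro member_le_sum) auto
    then show "(norm (X *v v i))\<^sup>2 \<le> (norm X)\<^sup>2"
      by (simp add: sum_norm_singular_frame_power2[OF on])
  qed simp
  have "sv_norm 1 X \<le> real CARD('n) * norm X"
    unfolding sv_norm_1[OF v] using sum_bounded_above[of UNIV "\<lambda>i. norm (X *v v i)" "norm X"] le by simp
  moreover have "sv_norm \<infinity> X \<le> norm X"
    unfolding sv_norm_inf[OF v] using le by (intro Max.boundedI) auto
  moreover have "norm X \<le> real CARD('n) * norm X"
    using mult_right_mono[of 1 "real CARD('n)" "norm X"] by (simp add: Suc_le_eq)
  ultimately show ?thesis using assms by (auto simp: sv_norm_2)
qed

section \<open>The vector norms for the three exponents\<close>

lemma vec_norm_1: "vec_norm 1 x = (\<Sum>i\<in>UNIV. \<bar>x $ i\<bar>)"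
proof -
  have "root 1 x = x" for x :: real by simp
  then show ?thesis by (simp add: vec_norm_def lp_norm_def one_enat_def)
qed

lemma vec_norm_2: "vec_norm 2 x = norm x"
  by (simp add: vec_norm_def lp_norm_2 norm_vec_def L2_set_def)

lemma vec_norm_inf: "vec_norm \<infinity> x = Max (range (\<lambda>i. \<bar>x $ i\<bar>))"
  by (simp add: vec_norm_def lp_norm_def)

lemma vec_norm_scaleR:
  assumes "\<beta> \<in> {1, 2, \<infinity>}"
  shows "vec_norm \<beta> (a *\<^sub>R x) = \<bar>a\<bar> * vec_norm \<beta> x"
proof -
  have "Max (range (\<lambda>i. \<bar>a\<bar> * \<bar>x $ i\<bar>)) = \<bar>a\<bar> * Max (range (\<lambda>i. \<bar>x $ i\<bar>))"
    using mono_Max_commute[of "\<lambda>x. \<bar>a\<bar> * x" "range (\<lambda>i. \<bar>x $ i\<bar>)"]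
    by (simp add: mono_def mult_left_mono image_image)
  then show ?thesis
    using assms by (auto simp: vec_norm_1 vec_norm_2 vec_norm_inf abs_mult sum_distrib_left)
qed

lemma vec_norm_triangle:
  assumes "\<beta> \<in> {1, 2, \<infinity>}"
  shows "vec_norm \<beta> (x + y) \<le> vec_norm \<beta> x + vec_norm \<beta> y"
proof -
  have "vec_norm \<infinity> (x + y) \<le> vec_norm \<infinity> x + vec_norm \<infinity> y"
    unfolding vec_norm_inf
    by (intro Max.boundedI) (auto intro!: order_trans[OF abs_triangle_ineq] add_mono)
  moreover have "vec_norm 1 (x + y) \<le> vec_norm 1 x + vec_norm 1 y"
    unfolding vec_norm_1 by (simp add: sum.distrib[symmetric] sum_mono abs_triangle_ineq)
  ultimately show ?thesis using assms by (auto simp: vec_norm_2 norm_triangle_ineq)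
qed

lemma norm_le_vec_norm:
  fixes x :: "real^'p"
  assumes "\<beta> \<in> {1, 2, \<infinity>}"
  shows "norm x \<le> (if \<beta> = \<infinity> then sqrt (real CARD('p)) else 1) * vec_norm \<beta> x"
proof -
  have K: "\<bar>x $ i\<bar> \<le> vec_norm \<infinity> x" for i by (simp add: vec_norm_inf)
  then have K0: "0 \<le> vec_norm \<infinity> x" using abs_ge_zero order_trans by blast
  have "(norm x)\<^sup>2 = (\<Sum>i\<in>UNIV. \<bar>x $ i\<bar>\<^sup>2)"
    by (simp add: norm_vec_def L2_set_def sum_nonneg)
  also have "\<dots> \<le> (\<Sum>i\<in>(UNIV :: 'p set). (vec_norm \<infinity> x)\<^sup>2)"
    by (intro sum_mono power_mono K) auto
  also have "\<dots> = (sqrt (real CARD('p)) * vec_norm \<infinity> x)\<^sup>2"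
    by (simp add: power_mult_distrib)
  finally have "norm x \<le> sqrt (real CARD('p)) * vec_norm \<infinity> x"
    by (rule power2_le_imp_le) (simp add: K0)
  then show ?thesis using assms norm_le_l1_cart[of x] by (auto simp: vec_norm_2 vec_norm_1)
qed

lemma vec_norm_le_norm:
  fixes x :: "real^'p"
  assumes "\<beta> \<in> {1, 2, \<infinity>}"
  shows "vec_norm \<beta> x \<le> real CARD('p) * norm x"
proof -
  have le: "\<bar>x $ i\<bar> \<le> norm x" for i by (simp add: component_le_norm_cart)
  have "vec_norm 1 x \<le> real CARD('p) * norm x"
    unfolding vec_norm_1 using sum_bounded_above[of UNIV "\<lambda>i. \<bar>x $ i\<bar>" "norm x"] le by simp
  moreover have "vec_norm \<infinity> x \<le> norm x"
    unfolding vec_norm_inf using le by (intro Max.boundedI) auto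
  moreover have "norm x \<le> real CARD('p) * norm x"
    using mult_right_mono[of 1 "real CARD('p)" "norm x"] by (simp add: Suc_le_eq)
  ultimately show ?thesis using assms by (auto simp: vec_norm_2)
qed

section \<open>The accelerated proximal gradient method\<close>

lemma nonneg_if_affine_nonneg:
  fixes a b :: real
  assumes "\<And>t. 0 < t \<Longrightarrow> t \<le> 1 \<Longrightarrow> 0 \<le> a + t * b"
  shows "0 \<le> a"
proof (rule field_le_epsilon)
  fix e :: real assume "e > 0"
  define t where "t = min 1 (e / (\<bar>b\<bar> + 1))"
  have t: "0 < t" "t \<le> 1" using \<open>e > 0\<close> by (auto simp: t_def)
  have "t * b \<le> t * (\<bar>b\<bar> + 1)" using t by (intro mult_left_mono) auto
  also have "\<dots> \<le> e / (\<bar>b\<bar> + 1) * (\<bar>b\<bar> + 1)"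
    by (intro mult_right_mono) (auto simp: t_def)
  also have "\<dots> = e" by (simp add: field_simps)
  finally show "0 \<le> a + e" using assms[OF t] by simp
qed

text \<open>First-order optimality along the segment from \<open>z\<close> to \<open>v\<close>:
  dividing the increment by \<open>t\<close> and letting \<open>t\<close> tend to 0 gives a
  variational inequality. Expanding \<open>v - c\<close> around \<open>z - c\<close> then exposes
  the extra quadratic term, the gain over plain minimality on which the accelerated rate
  rests.\<close>

lemma prox_three_point:
  fixes p :: "'a::real_inner \<Rightarrow> real"
  assumes convp: "convex_on K p" and "z \<in> K" "v \<in> K"
    and min: "\<And>v. v \<in> K \<Longrightarrow> p z + inner g (z - c) + L / 2 * (norm (z - c))\<^sup>2
                  \<le> p v + inner g (v - c) + L / 2 * (norm (v - c))\<^sup>2"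
  shows "p z + inner g (z - c) + L / 2 * (norm (z - c))\<^sup>2 + L / 2 * (norm (v - z))\<^sup>2
          \<le> p v + inner g (v - c) + L / 2 * (norm (v - c))\<^sup>2"
proof -
  have expand: "(norm (z + t *\<^sub>R (v - z) - c))\<^sup>2
      = (norm (z - c))\<^sup>2 + 2 * t * inner (z - c) (v - z) + t\<^sup>2 * (norm (v - z))\<^sup>2" for t
  proof -
    have "z + t *\<^sub>R (v - z) - c = (z - c) + t *\<^sub>R (v - z)" by simp
    then show ?thesis
      by (simp only: power2_norm_eq_inner inner_add_left inner_add_right inner_scaleR_left inner_scaleR_right)
        (simp add: inner_commute power2_eq_square algebra_simps)
  qed
  have "0 \<le> p v - p z + inner g (v - z) + L * inner (z - c) (v - z)"
  proof (rule nonneg_if_affine_nonneg)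
    fix t :: real assume t: "0 < t" "t \<le> 1"
    let ?w = "z + t *\<^sub>R (v - z)"
    have w: "?w = (1 - t) *\<^sub>R z + t *\<^sub>R v" by (simp add: algebra_simps)
    have "convex K" using convp by (simp add: convex_on_def)
    then have "?w \<in> K"
      unfolding w using t assms(2,3) by (intro convexD) auto
    from min[OF this] have "p z + inner g (z - c) + L / 2 * (norm (z - c))\<^sup>2
        \<le> p ?w + inner g (?w - c) + L / 2 * (norm (?w - c))\<^sup>2" .
    moreover have "p ?w \<le> (1 - t) * p z + t * p v"
      unfolding w using t assms(2,3) by (intro convex_onD[OF convp]) auto
    moreover have "inner g (?w - c) = inner g (z - c) + t * inner g (v - z)"
      by (simp add: inner_add_right inner_diff_right algebra_simps)
    ultimately have "0 \<le> t * (p v - p z + inner g (v - z) + L * inner (z - c) (v - z)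
        + t * (L / 2 * (norm (v - z))\<^sup>2))"
      unfolding expand by (simp add: algebra_simps power2_eq_square)
    then show "0 \<le> p v - p z + inner g (v - z) + L * inner (z - c) (v - z)
        + t * (L / 2 * (norm (v - z))\<^sup>2)"
      using t by (simp add: zero_le_mult_iff)
  qed
  moreover have "inner g (v - c) = inner g (z - c) + inner g (v - z)"
    by (simp add: inner_diff_right)
  moreover have "(norm (v - c))\<^sup>2
      = (norm (z - c))\<^sup>2 + 2 * inner (z - c) (v - z) + (norm (v - z))\<^sup>2"
    using expand[of 1] by simp
  then have "L / 2 * (norm (v - c))\<^sup>2
      = L / 2 * (norm (z - c))\<^sup>2 + L * inner (z - c) (v - z) + L / 2 * (norm (v - z))\<^sup>2"
    by (simp only: distrib_left)
  ultimately show ?thesis by linarith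
qed

text \<open>Average the two subgradient inequalities taken at the intermediate point; their linear
  parts cancel.\<close>

lemma convex_on_if_subgradient:
  fixes f :: "'a::real_inner \<Rightarrow> real"
  assumes "\<And>x v. f x + inner (g x) (v - x) \<le> f v"
  shows "convex_on UNIV f"
proof (rule convex_onI)
  fix t :: real and x y :: 'a assume t: "0 < t" "t < 1"
  define w where "w = (1 - t) *\<^sub>R x + t *\<^sub>R y"
  have "(1 - t) * (f w + inner (g w) (x - w)) \<le> (1 - t) * f x"
    and "t * (f w + inner (g w) (y - w)) \<le> t * f y"
    using t assms by (auto intro: mult_left_mono)
  moreover have "(1 - t) * (f w + inner (g w) (x - w)) + t * (f w + inner (g w) (y - w))
      = f w + inner (g w) ((1 - t) *\<^sub>R (x - w) + t *\<^sub>R (y - w))"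
    by (simp add: inner_add_right algebra_simps)
  moreover have "(1 - t) *\<^sub>R (x - w) + t *\<^sub>R (y - w) = 0"
    by (simp add: w_def algebra_simps)
  ultimately show "f ((1 - t) *\<^sub>R x + t *\<^sub>R y) \<le> (1 - t) * f x + t * f y"
    by (simp add: w_def)
qed simp

text \<open>The weights \<open>t l\<close> satisfy \<open>(t (l + 1))\<^sup>2 - t (l + 1) = (t l)\<^sup>2\<close>, which makes
  \<open>(t l)\<^sup>2 * (F (z\<^sub>1 l) - F x) + L / 2 * (norm (x - u l))\<^sup>2\<close> nonincreasing for
  \<open>u l = z\<^sub>1 (l - 1) + t l *\<^sub>R (z\<^sub>1 l - z\<^sub>1 (l - 1))\<close>. The starting point \<open>z\<close> need not lie
  in \<open>K\<close>, since \<open>t 1 = 1\<close> removes it from the first convex combination.\<close>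

lemma accelerated_proximal_gradient_bound:
  fixes p f :: "'a::real_inner \<Rightarrow> real" and t :: "nat \<Rightarrow> real"
  assumes convp: "convex_on K p" and "0 \<le> L"
    and subgrad: "\<And>x v. f x + inner (g x) (v - x) \<le> f v"
    and descent: "\<And>x v. f v \<le> f x + inner (g x) (v - x) + L / 2 * (norm (v - x))\<^sup>2"
    and z2_1: "z2 1 = z" and t1: "t 1 = 1"
    and argmin: "\<And>l. l \<in> {1..N} \<Longrightarrow> is_arg_min
          (\<lambda>v. p v + inner (g (z2 l)) (v - z2 l) + L / 2 * (norm (v - z2 l))\<^sup>2) (\<lambda>v. v \<in> K) (z1 l)"
    and t_Suc: "\<And>l. l \<in> {1..N} \<Longrightarrow> t (l + 1) = (1 + sqrt (1 + 4 * (t l)\<^sup>2)) / 2"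
    and z2_Suc: "\<And>l. l \<in> {1..N} \<Longrightarrow>
          z2 (l + 1) = z1 l + ((t l - 1) / t (l + 1)) *\<^sub>R (z1 l - z1 (l - 1))"
    and "x \<in> K" and "1 \<le> N"
  shows "p (z1 N) + f (z1 N) \<le> p x + f x + 2 * L * (norm (x - z))\<^sup>2 / (real N + 1)\<^sup>2"
proof -
  define F where "F v = p v + f v" for v
  have convK: "convex K" using convp by (simp add: convex_on_def)
  have "convex_on UNIV f" using subgrad by (rule convex_on_if_subgradient)
  then have "convex_on K f" by (rule convex_on_subset) (auto simp: convK)
  then have convF: "convex_on K F"
    unfolding F_def using convp by (intro convex_on_add) auto
  have z1K: "z1 l \<in> K" if "l \<in> {1..N}" for l
    using argmin[OF that] by (simp add: is_arg_min_def)
  \<comment> \<open>The three-point inequality for the model at \<open>z2 l\<close>;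
    \<open>descent\<close> passes to \<open>F\<close> on the left and \<open>subgrad\<close> on the
    right.\<close>
  have key: "F (z1 l) + L / 2 * (norm (v - z1 l))\<^sup>2 \<le> F v + L / 2 * (norm (v - z2 l))\<^sup>2"
    if l: "l \<in> {1..N}" and "v \<in> K" for l v
  proof -
    have "p (z1 l) + inner (g (z2 l)) (z1 l - z2 l) + L / 2 * (norm (z1 l - z2 l))\<^sup>2 + L / 2 * (norm (v - z1 l))\<^sup>2
          \<le> p v + inner (g (z2 l)) (v - z2 l) + L / 2 * (norm (v - z2 l))\<^sup>2"
      using argmin[OF l] \<open>v \<in> K\<close>
      by (intro prox_three_point[OF convp]) (auto simp: is_arg_min_def not_less)
    then show ?thesis
      using descent[of "z1 l" "z2 l"] subgrad[of "z2 l" v] unfolding F_def by linarith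
  qed
  \<comment> \<open>The weights grow by at least 1/2 per step, which is the source of the quadratic
    rate.\<close>
  have t_ge: "(real l + 1) / 2 \<le> t l" if "1 \<le> l" "l \<le> N + 1" for l
    using that
  proof (induction l rule: nat_induct_at_least)
    case (Suc l)
    then have IH: "(real l + 1) / 2 \<le> t l" by simp
    then have "0 \<le> t l" by (smt (verit) divide_nonneg_nonneg of_nat_0_le_iff)
    then have "2 * t l = sqrt (4 * (t l)\<^sup>2)" by (simp add: real_sqrt_mult)
    also have "\<dots> \<le> sqrt (1 + 4 * (t l)\<^sup>2)" by (rule real_sqrt_le_mono) simp
    finally show ?case using IH t_Suc[of l] Suc by (simp add: field_simps)
  qed (use t1 in simp)
  define u where "u l = z1 (l - 1) + t l *\<^sub>R (z1 l - z1 (l - 1))" for l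
  have energy: "(t l)\<^sup>2 * (F (z1 l) - F x) + L / 2 * (norm (x - u l))\<^sup>2 \<le> L / 2 * (norm (x - z))\<^sup>2"
    if "1 \<le> l" "l \<le> N" for l
    using that
  proof (induction l rule: nat_induct_at_least)
    case base
    have "u 1 = z1 1" using t1 by (simp add: u_def)
    then show ?case using key[of 1 x] base \<open>x \<in> K\<close> z2_1 t1 by simp
  next
    case (Suc l)
    then have l: "l \<in> {1..N}" "Suc l \<in> {1..N}" by auto
    define T where "T = t (Suc l)"
    have T: "1 \<le> T" using t_ge[of "Suc l"] Suc by (simp add: T_def)
    have T_eq: "T = (1 + sqrt (1 + 4 * (t l)\<^sup>2)) / 2" using t_Suc[OF l(1)] by (simp add: T_def)
    have "(2 * T - 1)\<^sup>2 = 1 + 4 * (t l)\<^sup>2" by (simp add: T_eq field_simps)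
    then have T2: "T\<^sup>2 - T = (t l)\<^sup>2" by (simp add: power2_eq_square algebra_simps)
    \<comment> \<open>The weight \<open>1 / T\<close> is chosen so that \<open>T\<close> times the
      vectors from \<open>z1 (Suc l)\<close> and \<open>z2 (Suc l)\<close> to \<open>v\<close> are
      those from \<open>u (Suc l)\<close> and \<open>u l\<close> to \<open>x\<close>. Multiplying
      \<open>key\<close> by the square of \<open>T\<close> then yields the energy
      inequality.\<close>
    define v where "v = (1 - 1 / T) *\<^sub>R z1 l + (1 / T) *\<^sub>R x"
    have v: "v \<in> K"
      unfolding v_def using T z1K[OF l(1)] \<open>x \<in> K\<close> by (intro convexD[OF convK]) auto
    have "F v \<le> (1 - 1 / T) * F (z1 l) + (1 / T) * F x"
      unfolding v_def using T z1K[OF l(1)] \<open>x \<in> K\<close> by (intro convex_onD[OF convF]) auto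
    then have "T\<^sup>2 * F v \<le> T\<^sup>2 * ((1 - 1 / T) * F (z1 l) + (1 / T) * F x)"
      by (rule mult_left_mono) simp
    also have "\<dots> = (T\<^sup>2 - T) * F (z1 l) + T * F x"
      using T by (simp add: field_simps power2_eq_square)
    finally have Fv: "T\<^sup>2 * F v \<le> (T\<^sup>2 - T) * F (z1 l) + T * F x" .
    have Tv: "T *\<^sub>R v = (T - 1) *\<^sub>R z1 l + x"
      using T by (simp add: v_def scaleR_add_right right_diff_distrib)
    have "T *\<^sub>R (v - z1 (Suc l)) = x - u (Suc l)"
      unfolding scaleR_diff_right Tv by (simp add: u_def T_def algebra_simps)
    then have n1: "T\<^sup>2 * (norm (v - z1 (Suc l)))\<^sup>2 = (norm (x - u (Suc l)))\<^sup>2"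
      by (metis norm_scaleR power2_abs power_mult_distrib)
    have "T *\<^sub>R z2 (Suc l) = T *\<^sub>R z1 l + (t l - 1) *\<^sub>R (z1 l - z1 (l - 1))"
      using z2_Suc[OF l(1)] T by (simp add: T_def[symmetric] scaleR_add_right)
    then have "T *\<^sub>R (v - z2 (Suc l)) = x - u l"
      unfolding scaleR_diff_right Tv by (simp add: u_def algebra_simps)
    then have n2: "T\<^sup>2 * (norm (v - z2 (Suc l)))\<^sup>2 = (norm (x - u l))\<^sup>2"
      by (metis norm_scaleR power2_abs power_mult_distrib)
    have "T\<^sup>2 * (F (z1 (Suc l)) + L / 2 * (norm (v - z1 (Suc l)))\<^sup>2)
        \<le> T\<^sup>2 * (F v + L / 2 * (norm (v - z2 (Suc l)))\<^sup>2)"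
      using key[OF l(2) v] by (rule mult_left_mono) simp
    then have "T\<^sup>2 * F (z1 (Suc l)) + L / 2 * (norm (x - u (Suc l)))\<^sup>2
        \<le> T\<^sup>2 * F v + L / 2 * (norm (x - u l))\<^sup>2"
      unfolding n1[symmetric] n2[symmetric] by (simp add: algebra_simps)
    also have "\<dots> \<le> (T\<^sup>2 - T) * F (z1 l) + T * F x + L / 2 * (norm (x - u l))\<^sup>2"
      using Fv by simp
    finally have "T\<^sup>2 * (F (z1 (Suc l)) - F x) + L / 2 * (norm (x - u (Suc l)))\<^sup>2
        \<le> (T\<^sup>2 - T) * (F (z1 l) - F x) + L / 2 * (norm (x - u l))\<^sup>2"
      by (simp add: algebra_simps)
    then show ?case using Suc by (simp add: T2 T_def[symmetric])
  qed
  have "(t N)\<^sup>2 * (F (z1 N) - F x) \<le> L / 2 * (norm (x - z))\<^sup>2"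
    using energy[OF \<open>1 \<le> N\<close> order_refl] \<open>0 \<le> L\<close> by (smt (verit) mult_nonneg_nonneg zero_le_power2 divide_nonneg_nonneg)
  have "F (z1 N) - F x \<le> 2 * L * (norm (x - z))\<^sup>2 / (real N + 1)\<^sup>2"
  proof (cases "F (z1 N) \<le> F x")
    case True
    then show ?thesis using \<open>0 \<le> L\<close> by (smt (verit) mult_nonneg_nonneg zero_le_power2 divide_nonneg_nonneg)
  next
    case False
    have "((real N + 1) / 2)\<^sup>2 * (F (z1 N) - F x) \<le> (t N)\<^sup>2 * (F (z1 N) - F x)"
      using t_ge[of N] False \<open>1 \<le> N\<close> by (intro mult_right_mono power_mono) auto
    also have "\<dots> \<le> L / 2 * (norm (x - z))\<^sup>2" by fact
    finally show ?thesis by (simp add: power_divide field_simps)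
  qed
  then show ?thesis by (simp add: F_def)
qed

section \<open>The subproblems\<close>

text \<open>\<open>gradient\<close> is a definite description, so uniqueness of the derivative has
  to be supplied.\<close>

lemma gradient_eqI: "GDERIV f x :> D \<Longrightarrow> gradient f x = D"
proof -
  assume D: "GDERIV f x :> D"
  have "E = D" if "GDERIV f x :> E" for E
  proof -
    have "(\<lambda>h. inner h E) = (\<lambda>h. inner h D)"
      using D that unfolding gderiv_def by (intro has_derivative_unique)
    then have "\<forall>h. inner h E = inner h D" by (auto dest: fun_cong)
    then show ?thesis by (simp add: vector_eq_ldot)
  qed
  with D show ?thesis unfolding gradient_def by (intro the_equality)
qed

text \<open>Exact because the function is quadratic: dropping the last term gives convexity,
  bounding it gives the descent estimate.\<close>

lemma half_norm_power2_expand: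
  fixes T :: "'a::real_vector \<Rightarrow> 'b::real_inner"
  assumes "linear T"
  shows "1/2 * (norm (T v - c))\<^sup>2
      = 1/2 * (norm (T x - c))\<^sup>2 + inner (T x - c) (T (v - x)) + 1/2 * (norm (T (v - x)))\<^sup>2"
proof -
  have "T v - c = (T x - c) + T (v - x)" by (simp add: linear_diff[OF assms])
  then show ?thesis
    by (simp only: power2_norm_eq_inner inner_add_left inner_add_right)
      (simp add: inner_commute algebra_simps)
qed

text \<open>Stated through inner products with \<open>h\<close>, so that the adjoint of
  \<open>T\<close> stays inside this proof.\<close>

lemma inner_gradient_half_norm_power2:
  fixes T :: "'a::euclidean_space \<Rightarrow> 'b::euclidean_space"
  assumes T: "linear T"
  shows "inner (gradient (\<lambda>x. 1/2 * (norm (T x - c))\<^sup>2) x) h = inner (T x - c) (T h)"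
proof -
  have bT: "bounded_linear T" using T by (simp add: linear_conv_bounded_linear)
  have dT: "(T has_derivative T) (at x)"
    by (rule bounded_linear_imp_has_derivative[OF bT])
  have "((\<lambda>x. 1/2 * inner (T x - c) (T x - c)) has_derivative
      (\<lambda>h. 1/2 * (inner (T x - c) (T h) + inner (T h) (T x - c)))) (at x)"
    by (rule derivative_eq_intros dT refl | simp)+
  then have "GDERIV (\<lambda>x. 1/2 * (norm (T x - c))\<^sup>2) x :> adjoint T (T x - c)"
    by (simp add: gderiv_def power2_norm_eq_inner adjoint_works[OF T] inner_commute)
  then have "gradient (\<lambda>x. 1/2 * (norm (T x - c))\<^sup>2) x = adjoint T (T x - c)"
    by (rule gradient_eqI)
  then show ?thesis by (simp add: adjoint_works[OF T] inner_commute)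
qed

lemma sum_UNIV_Plus:
  "(\<Sum>x\<in>(UNIV :: ('a::finite + 'b::finite) set). g x) = (\<Sum>i\<in>UNIV. g (Inl i)) + (\<Sum>j\<in>UNIV. g (Inr j))"
  using sum.Plus[of "UNIV :: 'a set" "UNIV :: 'b set" g] by (simp add: UNIV_Plus_UNIV)

lemma norm_vectorize [simp]: "norm (vectorize X) = norm X"
proof -
  have "(norm (vectorize X))\<^sup>2 = (\<Sum>ji\<in>UNIV \<times> UNIV. (X $ snd ji $ fst ji)\<^sup>2)"
    by (simp add: vectorize_def norm_vec_def L2_set_def sum_nonneg)
  also have "\<dots> = (\<Sum>i\<in>UNIV. \<Sum>j\<in>UNIV. (X $ i $ j)\<^sup>2)"
    by (subst sum.swap) (simp add: sum.cartesian_product case_prod_unfold)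
  also have "\<dots> = (norm X)\<^sup>2"
    by (simp add: norm_vec_def L2_set_def sum_nonneg)
  finally show ?thesis by simp
qed

text \<open>For \<open>m\<close> above 1, \<open>B\<close> is at most \<open>B * m\<close> and a
  factor \<open>m\<close> cancels; the summand 1 covers the remaining case.\<close>

lemma le_of_quadratic_le:
  fixes c m a B :: real
  assumes "0 < c" "0 \<le> a" "0 \<le> B" "c * m\<^sup>2 \<le> a * m + B"
  shows "m \<le> (a + B) / c + 1"
proof (cases "m \<le> 1")
  case True
  then show ?thesis using assms by (smt (verit) divide_nonneg_pos)
next
  case False
  then have "B \<le> B * m" using assms(3) mult_left_mono[of 1 m B] by simp
  then have "(c * m) * m \<le> (a + B) * m" using assms(4) by (simp add: power2_eq_square algebra_simps)
  then have "c * m \<le> a + B" using False by simp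
  then show ?thesis using assms(1) by (simp add: field_simps)
qed

lemma le_power2_add_1: "a \<le> a\<^sup>2 + (1::real)"
proof -
  have "0 \<le> (a - 1/2)\<^sup>2" by simp
  then show ?thesis by (simp add: power2_eq_square algebra_simps)
qed

lemma subdifferential_D: "g \<in> subdifferential f x \<Longrightarrow> f x + inner g (y - x) \<le> f y"
  by (simp add: subdifferential_def)

lemma convex_sublevel:
  fixes f :: "'a::real_vector \<Rightarrow> real"
  assumes "convex_on UNIV f"
  shows "convex {x. f x \<le> c}"
proof (rule convexI)
  fix x y :: 'a and u v :: real
  assume xy: "x \<in> {x. f x \<le> c}" "y \<in> {x. f x \<le> c}" and uv: "0 \<le> u" "0 \<le> v" "u + v = 1"
  then have "u = 1 - v" by simp
  then have "f (u *\<^sub>R x + v *\<^sub>R y) \<le> u * f x + v * f y"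
    using convex_onD[OF assms, of v x y] uv by (simp only: \<open>u = 1 - v\<close>) simp
  also have "\<dots> \<le> c"
    using xy uv by (intro convex_bound_le) auto
  finally show "u *\<^sub>R x + v *\<^sub>R y \<in> {x. f x \<le> c}" by simp
qed

lemma vec_norm_nonneg:
  assumes "\<beta> \<in> {1, 2, \<infinity>}"
  shows "0 \<le> vec_norm \<beta> x"
  using vec_norm_triangle[OF assms, of x "(-1) *\<^sub>R x"] vec_norm_scaleR[OF assms, of "-1" x]
    vec_norm_scaleR[OF assms, of 0 x] by simp

lemma sv_norm_nonneg:
  assumes "\<alpha> \<in> {1, 2, \<infinity>}"
  shows "0 \<le> sv_norm \<alpha> X"
  using sv_norm_triangle[OF assms, of X "(-1) *\<^sub>R X"] sv_norm_scaleR[OF assms, of "-1" X]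
    sv_norm_scaleR[OF assms, of 0 X] by simp

lemma convex_on_sv_norm:
  assumes "\<alpha> \<in> {1, 2, \<infinity>}"
  shows "convex_on UNIV (sv_norm \<alpha>)"
  by (rule convex_onI) (auto intro!: order_trans[OF sv_norm_triangle[OF assms]] simp: sv_norm_scaleR[OF assms])

lemma convex_on_vec_norm:
  assumes "\<beta> \<in> {1, 2, \<infinity>}"
  shows "convex_on UNIV (vec_norm \<beta>)"
  by (rule convex_onI) (auto intro!: order_trans[OF vec_norm_triangle[OF assms]] simp: vec_norm_scaleR[OF assms])

section \<open>The problem data and the smooth term\<close>

locale falc_data = falc \<alpha> \<beta> \<mu>\<^sub>1 \<mu>\<^sub>2 \<A> A \<C> C b d Q lam \<epsilon> \<tau> \<xi>
  for \<alpha> \<beta> :: enat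
    and \<mu>\<^sub>1 \<mu>\<^sub>2 :: real
    and \<A> :: "real^'n^'m \<Rightarrow> real^'q" and A :: "real^('n \<times> 'm)^'q"
    and \<C> :: "real^'n^'m \<Rightarrow> real^'p" and C :: "real^('n \<times> 'm)^'p"
    and b :: "real^'q" and d :: "real^'p"
    and Q :: "(real^'q) set"
    and lam \<epsilon> \<tau> \<xi> :: "nat \<Rightarrow> real" +
  assumes \<alpha>: "\<alpha> \<in> {1, 2, \<infinity>}" and \<beta>: "\<beta> \<in> {1, 2, \<infinity>}"
    and \<mu>\<^sub>1_pos: "\<mu>\<^sub>1 > 0" and \<mu>\<^sub>2_pos: "\<mu>\<^sub>2 > 0"
    and lin\<A>: "linear \<A>" and surj\<A>: "surj \<A>" and \<A>_eq: "\<And>Z. \<A> Z = A *v vectorize Z"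
    and lin\<C>: "linear \<C>" and \<C>_eq: "\<And>Z. \<C> Z = C *v vectorize Z"
    and Q_ne: "Q \<noteq> {}" and Q_closed: "closed Q" and Q_convex: "convex Q"
begin

text \<open>The two residuals without their constants. \<open>f\<close> is half the squared distance
  from \<open>T z\<close> to a point carrying the multipliers, so its convexity and smoothness
  follow from linearity of \<open>T\<close>. In coordinates \<open>T\<close> is \<open>M\<close> up
  to the order of the blocks.\<close>

definition T :: "(real^'n^'m) \<times> (real^'p) \<times> (real^'q) \<Rightarrow> (real^'q) \<times> (real^'p)" where
  "T = (\<lambda>(X, s, y). (\<A> X - y, \<C> X - s))"

lemma linear_T: "linear T"
  unfolding T_def
  by (rule linearI) (auto simp: linear_add[OF lin\<A>] linear_add[OF lin\<C>] linear_scale[OF lin\<A>]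
      linear_scale[OF lin\<C>] scaleR_diff_right)

lemma f_eq: "f k u w = (\<lambda>z. 1/2 * (norm (T z - (b + lam k *\<^sub>R u, d + lam k *\<^sub>R w)))\<^sup>2)"
  by (auto simp: fun_eq_iff f_def T_def norm_prod_def algebra_simps)

lemma inner_gradient_f:
  "inner (gradient (f k u w) z) h = inner (T z - (b + lam k *\<^sub>R u, d + lam k *\<^sub>R w)) (T h)"
  unfolding f_eq by (rule inner_gradient_half_norm_power2[OF linear_T])

lemma f_expand:
  "f k u w v = f k u w z + inner (gradient (f k u w) z) (v - z) + 1/2 * (norm (T (v - z)))\<^sup>2"
  unfolding inner_gradient_f unfolding f_eq by (rule half_norm_power2_expand[OF linear_T])

lemma f_subgradient: "f k u w z + inner (gradient (f k u w) z) (v - z) \<le> f k u w v"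
  unfolding f_expand[of k u w v z] by simp

lemma norm_T_le: "(norm (T z))\<^sup>2 \<le> L * (norm z)\<^sup>2"
proof -
  obtain X s y where z: "z = (X, s, y)" by (cases z)
  \<comment> \<open>The coordinates are stacked in the order of the columns of \<open>M\<close>,
    which preserves the norm.\<close>
  define v :: "real^('p + 'q + 'n \<times> 'm)" where
    "v = (\<chi> c. case c of Inl i \<Rightarrow> s $ i | Inr (Inl i) \<Rightarrow> y $ i | Inr (Inr e) \<Rightarrow> vectorize X $ e)"
  have norm2: "(norm x)\<^sup>2 = (\<Sum>i\<in>UNIV. (x $ i)\<^sup>2)" for x :: "real^'z"
    by (simp add: norm_vec_def L2_set_def sum_nonneg)
  have "(norm v)\<^sup>2 = (norm s)\<^sup>2 + ((norm y)\<^sup>2 + (norm (vectorize X))\<^sup>2)"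
    unfolding norm2 sum_UNIV_Plus by (simp add: v_def)
  then have nv: "(norm v)\<^sup>2 = (norm z)\<^sup>2"
    by (simp add: z norm_prod_def)
  have "(M *v v) $ Inl i = \<C> X $ i - s $ i" for i
    unfolding \<C>_eq matrix_vector_mult_def
    by (simp add: M_def v_def sum_UNIV_Plus sum_negf if_distrib[of "\<lambda>x. x * _"] cong: if_cong)
  moreover have "(M *v v) $ Inr i = \<A> X $ i - y $ i" for i
    unfolding \<A>_eq matrix_vector_mult_def
    by (simp add: M_def v_def sum_UNIV_Plus sum_negf if_distrib[of "\<lambda>x. x * _"] cong: if_cong)
  ultimately have "(norm (M *v v))\<^sup>2 = (norm (T z))\<^sup>2"
    unfolding norm2 sum_UNIV_Plus by (simp add: z T_def norm_prod_def norm2 sum_nonneg)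
  moreover have "(norm (M *v v))\<^sup>2 \<le> (sigma_max M * norm v)\<^sup>2"
    by (intro power_mono norm_le_sigma_max_mult) auto
  ultimately show ?thesis by (simp add: power_mult_distrib nv L_def)
qed

lemma f_descent:
  "f k u w v \<le> f k u w z + inner (gradient (f k u w) z) (v - z) + L / 2 * (norm (v - z))\<^sup>2"
  unfolding f_expand[of k u w v z] using norm_T_le[of "v - z"] by simp

lemma L_pos: "L > 0"
proof -
  obtain e :: "real^'q" where "norm e = 1" using vector_choose_size[of 1] by auto
  \<comment> \<open>On \<open>(0, 0, e)\<close> the map \<open>T\<close> preserves the norm, since
    it acts on the \<open>y\<close>-part as minus the identity.\<close>
  then have "1 \<le> L" using norm_T_le[of "(0, 0, e)"]
    by (simp add: T_def norm_prod_def linear_0[OF lin\<A>] linear_0[OF lin\<C>])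
  then show ?thesis by simp
qed

lemma norm_\<A>_le: "norm (\<A> X) \<le> sigma_max A * norm X"
  unfolding \<A>_eq using norm_le_sigma_max_mult[of A "vectorize X"] by simp

lemma norm_le_I\<alpha>: "norm (X :: real^'n^'m) \<le> I\<alpha> * sv_norm \<alpha> X"
  using norm_le_sv_norm[OF \<alpha>, of X] by (simp add: I\<alpha>_def)

lemma norm_le_J\<beta>: "norm (s :: real^'p) \<le> J\<beta> * vec_norm \<beta> s"
  using norm_le_vec_norm[OF \<beta>, of s] by (simp add: J\<beta>_def)

lemma I\<alpha>_nonneg: "0 \<le> I\<alpha>" and J\<beta>_nonneg: "0 \<le> J\<beta>"
  by (simp_all add: I\<alpha>_def J\<beta>_def)

lemma convex_on_p:
  assumes "lam k > 0"
  shows "convex_on UNIV (p k)"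
proof -
  have "convex_on UNIV (\<lambda>z :: (real^'n^'m) \<times> (real^'p) \<times> (real^'q). sv_norm \<alpha> (fst z))"
    by (intro convex_onI) (auto intro!: convex_onD[OF convex_on_sv_norm[OF \<alpha>]])
  moreover have "convex_on UNIV (\<lambda>z :: (real^'n^'m) \<times> (real^'p) \<times> (real^'q). vec_norm \<beta> (fst (snd z)))"
    by (intro convex_onI) (auto intro!: convex_onD[OF convex_on_vec_norm[OF \<beta>]])
  ultimately show ?thesis
    unfolding p_def case_prod_unfold using assms \<mu>\<^sub>1_pos \<mu>\<^sub>2_pos
    by (intro convex_on_cmul convex_on_add) auto
qed

lemma convex_feasible: "convex {z. z \<in> S X0 k u w \<and> snd (snd z) \<in> Q}"
proof -
  have "convex {X :: real^'n^'m. sv_norm \<alpha> X \<le> c}" for c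
    by (rule convex_sublevel[OF convex_on_sv_norm[OF \<alpha>]])
  moreover have "convex {s :: real^'p. vec_norm \<beta> s \<le> c}" for c
    by (rule convex_sublevel[OF convex_on_vec_norm[OF \<beta>]])
  moreover have "{z. z \<in> S X0 k u w \<and> snd (snd z) \<in> Q}
      = {X. sv_norm \<alpha> X \<le> \<eta>\<^sub>1 X0 k u w / \<mu>\<^sub>1} \<times> {s. vec_norm \<beta> s \<le> \<eta>\<^sub>1 X0 k u w / \<mu>\<^sub>2} \<times> Q"
    using \<mu>\<^sub>1_pos \<mu>\<^sub>2_pos by (auto simp: S_def field_simps)
  ultimately show ?thesis using Q_convex by (simp add: convex_Times)
qed

section \<open>The penalized objective and the error of the inner routine\<close>

definition P :: "nat \<Rightarrow> real^'q \<Rightarrow> real^'p \<Rightarrow> (real^'n^'m) \<times> (real^'p) \<times> (real^'q) \<Rightarrow> real" where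
  "P k u w z = p k z + f k u w z"

lemma f_nonneg: "0 \<le> f k u w z"
  by (simp add: f_eq)

text \<open>A finite convex function on a finite-dimensional space is continuous, so continuity of
  singular values never has to be shown.\<close>

lemma continuous_P:
  assumes "lam k > 0"
  shows "continuous_on UNIV (P k u w)"
proof -
  have "convex_on UNIV (f k u w)"
    using f_subgradient by (rule convex_on_if_subgradient)
  then have "convex_on UNIV (P k u w)"
    unfolding P_def using convex_on_p[OF assms] by (intro convex_on_add)
  then show ?thesis by (rule convex_on_continuous[OF open_UNIV])
qed

lemma norm_triple_le:
  "norm (X :: real^'n^'m, s :: real^'p, y :: real^'q) \<le> norm X + norm s + norm y"
  using norm_Pair_le[of X "(s, y)"] norm_Pair_le[of s y] by linarith

text \<open>The sublevel set through the starting point is compact, so a minimizer under the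
  constraint \<open>y\<close> in \<open>Q\<close> alone exists; the sublevel bound itself puts it
  into \<open>S\<close>. Hence restricting the inner steps to \<open>S\<close> does not exclude
  it.\<close>

lemma subproblem_minimizer:
  assumes lam: "lam k > 0" and X0: "\<A> X0 - b \<in> Q"
  obtains z where "z \<in> S X0 k u w" "snd (snd z) \<in> Q"
    and "\<And>v. snd (snd v) \<in> Q \<Longrightarrow> P k u w z \<le> P k u w v"
    and "norm z \<le> (I\<alpha> / \<mu>\<^sub>1 + J\<beta> / \<mu>\<^sub>2) * \<eta>\<^sub>1 X0 k u w + \<eta>\<^sub>2 X0 k u w"
proof -
  define z0 where "z0 = (X0, \<C> X0 - d, \<A> X0 - b)"
  define e where "e = \<eta>\<^sub>1 X0 k u w"
  \<comment> \<open>At \<open>z0\<close> both residuals reduce to minus \<open>lam k\<close> times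
    the multipliers. This is the origin of \<open>\<eta>\<^sub>1\<close>.\<close>
  have Pz0: "P k u w z0 = lam k * e"
    by (simp add: P_def p_def f_def z0_def e_def \<eta>\<^sub>1_def objective_def power_mult_distrib power2_eq_square algebra_simps)
  define G where "G = {z. snd (snd z) \<in> Q \<and> P k u w z \<le> P k u w z0}"
  have GX: "sv_norm \<alpha> X \<le> e / \<mu>\<^sub>1" and Gs: "vec_norm \<beta> s \<le> e / \<mu>\<^sub>2"
    and Gr: "(norm (\<A> X - y - b - lam k *\<^sub>R u))\<^sup>2 \<le> 2 * lam k * e"
    if "(X, s, y) \<in> G" for X s y
  proof -
    have le: "p k (X, s, y) + f k u w (X, s, y) \<le> lam k * e"
      using that Pz0 by (simp add: G_def P_def)
    have nn: "0 \<le> \<mu>\<^sub>1 * sv_norm \<alpha> X" "0 \<le> \<mu>\<^sub>2 * vec_norm \<beta> s"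
      by (simp_all add: \<mu>\<^sub>1_pos \<mu>\<^sub>2_pos sv_norm_nonneg[OF \<alpha>] vec_norm_nonneg[OF \<beta>] less_imp_le)
    have "lam k * (\<mu>\<^sub>1 * sv_norm \<alpha> X + \<mu>\<^sub>2 * vec_norm \<beta> s) \<le> lam k * e"
      using le f_nonneg[of k u w "(X, s, y)"] by (simp add: p_def)
    then have "\<mu>\<^sub>1 * sv_norm \<alpha> X + \<mu>\<^sub>2 * vec_norm \<beta> s \<le> e" using lam by simp
    then show "sv_norm \<alpha> X \<le> e / \<mu>\<^sub>1" "vec_norm \<beta> s \<le> e / \<mu>\<^sub>2"
      using nn \<mu>\<^sub>1_pos \<mu>\<^sub>2_pos by (simp_all add: field_simps)
    have "0 \<le> p k (X, s, y)" using nn lam by (simp add: p_def)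
    moreover have "1/2 * (norm (\<A> X - y - b - lam k *\<^sub>R u))\<^sup>2 \<le> f k u w (X, s, y)"
      by (simp add: f_def)
    ultimately show "(norm (\<A> X - y - b - lam k *\<^sub>R u))\<^sup>2 \<le> 2 * lam k * e"
      using le by linarith
  qed
  have nX: "norm X \<le> I\<alpha> * (e / \<mu>\<^sub>1)" and ns: "norm s \<le> J\<beta> * (e / \<mu>\<^sub>2)" if "(X, s, y) \<in> G" for X s y
    using norm_le_I\<alpha>[of X] mult_left_mono[OF GX[OF that] I\<alpha>_nonneg]
      norm_le_J\<beta>[of s] mult_left_mono[OF Gs[OF that] J\<beta>_nonneg] by auto
  have nAX: "norm (\<A> X) \<le> sigma_max A * (I\<alpha> * (e / \<mu>\<^sub>1))" if "(X, s, y) \<in> G" for X s y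
    using norm_\<A>_le[of X] mult_left_mono[OF nX[OF that] sigma_max_nonneg[of A]] by simp
  \<comment> \<open>A crude radius, used for compactness alone, with \<open>y\<close> controlled
    through its residual. The radius in the conclusion relies on minimality.\<close>
  have "norm z \<le> I\<alpha> * (e / \<mu>\<^sub>1) + (J\<beta> * (e / \<mu>\<^sub>2) + (sigma_max A * (I\<alpha> * (e / \<mu>\<^sub>1)) + norm (b + lam k *\<^sub>R u) + (2 * lam k * e + 1)))"
    if "z \<in> G" for z
  proof -
    obtain X s y where z: "z = (X, s, y)" by (cases z)
    let ?r = "\<A> X - y - b - lam k *\<^sub>R u"
    have "norm ?r \<le> (norm ?r)\<^sup>2 + 1"
      by (rule le_power2_add_1)
    then have r: "norm ?r \<le> 2 * lam k * e + 1" using Gr[OF that[unfolded z]] by linarith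
    have "norm y = norm (\<A> X - (b + lam k *\<^sub>R u) - ?r)" by simp
    then have "norm y \<le> norm (\<A> X) + norm (b + lam k *\<^sub>R u) + norm ?r"
      using norm_triangle_ineq4[of "\<A> X - (b + lam k *\<^sub>R u)" ?r]
        norm_triangle_ineq4[of "\<A> X" "b + lam k *\<^sub>R u"] by linarith
    then show ?thesis
      using norm_triple_le[of X s y] nX[OF that[unfolded z]] ns[OF that[unfolded z]] nAX[OF that[unfolded z]] r
      unfolding z by linarith
  qed
  then have "bounded G" unfolding bounded_iff by blast
  moreover have "closed G"
  proof -
    have "closed ((\<lambda>z. snd (snd z)) -` Q :: ((real^'n^'m) \<times> (real^'p) \<times> (real^'q)) set)"
      by (intro closed_vimage Q_closed continuous_intros)
    moreover have "closed {z. P k u w z \<le> P k u w z0}"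
      by (intro closed_Collect_le continuous_P lam continuous_on_const)
    moreover have "G = (\<lambda>z. snd (snd z)) -` Q \<inter> {z. P k u w z \<le> P k u w z0}"
      by (auto simp: G_def)
    ultimately show ?thesis by (metis closed_Int)
  qed
  ultimately have "compact G" by (simp add: compact_eq_bounded_closed)
  moreover have z0G: "z0 \<in> G" using X0 by (simp add: G_def z0_def)
  moreover have "continuous_on G (P k u w)"
    using continuous_P[OF lam] continuous_on_subset by blast
  ultimately obtain z where z: "z \<in> G" and minG: "\<And>v. v \<in> G \<Longrightarrow> P k u w z \<le> P k u w v"
    using continuous_attains_inf[of G "P k u w"] by blast
  have min: "P k u w z \<le> P k u w v" if "snd (snd v) \<in> Q" for v
  proof (cases "v \<in> G")
    case False
    then show ?thesis using that z by (simp add: G_def)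
  qed (rule minG)
  obtain X s y where zz: "z = (X, s, y)" by (cases z)
  define a where "a = \<A> X - b - lam k *\<^sub>R u"
  \<comment> \<open>With \<open>X\<close> and \<open>s\<close> fixed, minimality in \<open>y\<close>
    is nearest-point minimality. As the projection is nonexpansive and fixes
    \<open>\<A> X0 - b\<close>, the norm of \<open>y\<close> exceeds that of \<open>a\<close> by at
    most twice the norm of \<open>\<A> X0 - b\<close>, which explains the last term of
    \<open>\<eta>\<^sub>2\<close>.\<close>
  have "y = closest_point Q a"
  proof (rule closest_point_unique[OF Q_convex Q_closed])
    show "y \<in> Q" using z zz by (simp add: G_def)
    show "\<forall>y'\<in>Q. dist a y \<le> dist a y'"
    proof
      fix y' assume "y' \<in> Q"
      then have "P k u w (X, s, y) \<le> P k u w (X, s, y')" using min[of "(X, s, y')"] zz by simp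
      then have "(norm (a - y))\<^sup>2 \<le> (norm (a - y'))\<^sup>2"
        by (simp add: P_def p_def f_def a_def algebra_simps)
      then show "dist a y \<le> dist a y'" by (simp add: dist_norm)
    qed
  qed
  moreover have "closest_point Q (\<A> X0 - b) = \<A> X0 - b" by (rule closest_point_self[OF X0])
  ultimately have "dist y (\<A> X0 - b) \<le> dist a (\<A> X0 - b)"
    using closest_point_lipschitz[OF Q_convex Q_closed Q_ne, of a "\<A> X0 - b"] by simp
  then have "norm y \<le> norm a + 2 * norm (\<A> X0 - b)"
    unfolding dist_norm
    using norm_triangle_ineq4[of a "\<A> X0 - b"] norm_triangle_sub[of y "\<A> X0 - b"] by linarith
  moreover have "norm a \<le> norm (\<A> X) + norm (b + lam k *\<^sub>R u)"
    using norm_triangle_ineq4[of "\<A> X" "b + lam k *\<^sub>R u"] by (simp add: a_def algebra_simps)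
  ultimately have "norm y \<le> \<eta>\<^sub>2 X0 k u w"
    using nAX[OF z[unfolded zz]] by (simp add: \<eta>\<^sub>2_def e_def[symmetric])
  then have "norm z \<le> (I\<alpha> / \<mu>\<^sub>1 + J\<beta> / \<mu>\<^sub>2) * e + \<eta>\<^sub>2 X0 k u w"
    using norm_triple_le[of X s y] nX[OF z[unfolded zz]] ns[OF z[unfolded zz]] by (simp add: zz algebra_simps)
  moreover have "z \<in> S X0 k u w"
    using GX[OF z[unfolded zz]] Gs[OF z[unfolded zz]] \<mu>\<^sub>1_pos \<mu>\<^sub>2_pos
    by (simp add: zz S_def e_def[symmetric] field_simps)
  moreover have "snd (snd z) \<in> Q" using z by (simp add: G_def)
  ultimately show ?thesis using that min e_def by blast
qed

text \<open>\<open>lmax\<close> is \<open>sqrt (2 * L / \<epsilon> k)\<close> times a bound on the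
  distance from the start to a minimizer, so the accelerated rate falls below
  \<open>\<epsilon> k\<close>. The comparison passes through that minimizer because \<open>v\<close>
  itself may lie outside \<open>S\<close>.\<close>

lemma ITERstop_error:
  assumes lam: "lam k > 0" and \<epsilon>: "\<epsilon> k > 0" and X0: "\<A> X0 - b \<in> Q"
    and z2_1: "z2 1 = z" and z1_0: "z1 0 = z" and t1: "t 1 = 1"
    and steps: "\<And>l. l \<in> {1..N} \<Longrightarrow>
        is_arg_min
          (\<lambda>v. p k v + inner (gradient (f k u w) (z2 l)) (v - z2 l) + L / 2 * (norm (v - z2 l))\<^sup>2)
          (\<lambda>v. v \<in> S X0 k u w \<and> snd (snd v) \<in> Q)
          (z1 l) \<and>
        t (l + 1) = (1 + sqrt (1 + 4 * (t l)\<^sup>2)) / 2 \<and>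
        z2 (l + 1) = z1 l + ((t l - 1) / t (l + 1)) *\<^sub>R (z1 l - z1 (l - 1))"
    and stop: "real N \<ge> lmax X0 k u w z" and v: "snd (snd v) \<in> Q"
  shows "P k u w (z1 N) \<le> P k u w v + \<epsilon> k"
proof -
  obtain zs where zs: "zs \<in> S X0 k u w" "snd (snd zs) \<in> Q"
    and min: "\<And>v. snd (snd v) \<in> Q \<Longrightarrow> P k u w zs \<le> P k u w v"
    and nzs: "norm zs \<le> (I\<alpha> / \<mu>\<^sub>1 + J\<beta> / \<mu>\<^sub>2) * \<eta>\<^sub>1 X0 k u w + \<eta>\<^sub>2 X0 k u w"
    using subproblem_minimizer[OF lam X0] by metis
  obtain X s y where z: "z = (X, s, y)" by (cases z)
  define R where "R = (I\<alpha> / \<mu>\<^sub>1 + J\<beta> / \<mu>\<^sub>2) * \<eta>\<^sub>1 X0 k u w + \<eta>\<^sub>2 X0 k u w + norm X + norm s + norm y"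
  have lmax: "lmax X0 k u w z = sqrt (2 * L / \<epsilon> k) * R" by (simp add: lmax_def z R_def)
  have R: "norm (zs - z) \<le> R"
    using norm_triangle_ineq4[of zs z] nzs norm_triple_le[of X s y] by (simp add: z R_def)
  have "P k u w (z1 N) \<le> P k u w zs + \<epsilon> k"
  proof (cases "N = 0")
    case True
    \<comment> \<open>Stopping before the first step forces a nonpositive bound on the distance, so
      the starting point already is the minimizer.\<close>
    then have "sqrt (2 * L / \<epsilon> k) * R \<le> 0" using stop lmax by simp
    moreover have "0 < sqrt (2 * L / \<epsilon> k)" using L_pos \<epsilon> by simp
    ultimately have "R \<le> 0" by (meson mult_pos_pos not_le)
    then have "norm (zs - z) \<le> 0" using R by linarith
    then have "zs = z" by simp
    then show ?thesis using True z1_0 \<epsilon> by simp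
  next
    case False
    define K where "K = {z. z \<in> S X0 k u w \<and> snd (snd z) \<in> Q}"
    have "convex_on K (p k)"
      by (rule convex_on_subset[OF convex_on_p[OF lam]]) (auto simp: K_def convex_feasible)
    note bound = accelerated_proximal_gradient_bound[where f = "f k u w" and g = "gradient (f k u w)"
        and ?z1.0 = z1 and ?z2.0 = z2 and t = t and N = N,
        OF this less_imp_le[OF L_pos] f_subgradient f_descent z2_1 t1]
    have "p k (z1 N) + f k u w (z1 N)
        \<le> p k zs + f k u w zs + 2 * L * (norm (zs - z))\<^sup>2 / (real N + 1)\<^sup>2"
    proof (rule bound)
      show "zs \<in> K" using zs by (simp add: K_def)
      show "1 \<le> N" using False by simp
    qed (use steps in \<open>simp_all add: K_def\<close>)
    also have "2 * L * (norm (zs - z))\<^sup>2 / (real N + 1)\<^sup>2 \<le> \<epsilon> k"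
    proof -
      have "0 \<le> R" using R norm_ge_zero order_trans by blast
      then have "(sqrt (2 * L / \<epsilon> k) * R)\<^sup>2 \<le> (real N + 1)\<^sup>2"
        using stop lmax L_pos \<epsilon> by (intro power_mono) auto
      then have "2 * L / \<epsilon> k * R\<^sup>2 \<le> (real N + 1)\<^sup>2"
        using L_pos \<epsilon> by (simp add: power_mult_distrib)
      moreover have "2 * L / \<epsilon> k * (norm (zs - z))\<^sup>2 \<le> 2 * L / \<epsilon> k * R\<^sup>2"
        using R L_pos \<epsilon> by (intro mult_left_mono power_mono) auto
      ultimately have "2 * L / \<epsilon> k * (norm (zs - z))\<^sup>2 \<le> (real N + 1)\<^sup>2" by linarith
      then have "2 * L * (norm (zs - z))\<^sup>2 \<le> \<epsilon> k * (real N + 1)\<^sup>2"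
        using \<epsilon> by (simp add: field_simps)
      then show ?thesis by (simp add: divide_le_eq)
    qed
    finally show ?thesis by (simp add: P_def)
  qed
  then show ?thesis using min[OF v] by linarith
qed

text \<open>Convexity bounds the gap by partial gradients. In \<open>X\<close> and \<open>s\<close>
  these combine with subgradients of the norms into vectors of size at most \<open>\<tau> k\<close>.
  In \<open>y\<close> the gradient is \<open>- r\<close>, which the test does not make small; its
  term is kept apart, vanishes for \<open>y' = y\<close>, and for \<open>y'\<close> in
  \<open>Q\<close> is controlled by the projection test.\<close>

lemma GRADstop_error:
  assumes lam: "lam k > 0" and stop: "GRADstop k u w (X, s, y)"
    and r_def: "r = \<A> X - y - b - lam k *\<^sub>R u"
  shows "P k u w (X, s, y) \<le> P k u w (X', s', y') + \<tau> k * (norm (X' - X) + norm (s' - s)) + inner r (y' - y)"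
    and "y' \<in> Q \<Longrightarrow> inner r (y' - y) \<le> L * \<xi> k * (norm (y' - y) + \<xi> k) + \<xi> k * norm r"
proof -
  define q where "q = \<C> X - s - d - lam k *\<^sub>R w"
  define gX where "gX = gradient (\<lambda>X'. f k u w (X', s, y)) X"
  define gs where "gs = gradient (\<lambda>s'. f k u w (X, s', y)) s"
  define gy where "gy = gradient (\<lambda>y'. f k u w (X, s, y')) y"
  have gX: "inner gX h = inner r (\<A> h) + inner q (\<C> h)" for h
  proof -
    have "(\<lambda>X'. f k u w (X', s, y)) = (\<lambda>X'. 1/2 * (norm ((\<A> X', \<C> X')
        - (y + b + lam k *\<^sub>R u, s + d + lam k *\<^sub>R w)))\<^sup>2)"
      by (auto simp: fun_eq_iff f_def norm_prod_def algebra_simps)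
    moreover have "linear (\<lambda>X. (\<A> X, \<C> X))"
      using lin\<A> lin\<C> by (auto intro!: linearI simp: linear_add linear_scale)
    ultimately show ?thesis
      unfolding gX_def by (simp only: inner_gradient_half_norm_power2) (simp add: r_def q_def algebra_simps)
  qed
  have gs: "inner gs h = - inner q h" for h
  proof -
    \<comment> \<open>The zero component of the linear map carries the first residual, constant in
      \<open>s'\<close>, so that the function has the form required by
      \<open>inner_gradient_half_norm_power2\<close>.\<close>
    have "(\<lambda>s'. f k u w (X, s', y)) = (\<lambda>s'. 1/2 * (norm ((0 :: real^'q, - s') - (- r, - (\<C> X - d - lam k *\<^sub>R w))))\<^sup>2)"
      by (auto simp: fun_eq_iff f_def norm_prod_def r_def algebra_simps)
    moreover have "linear (\<lambda>s :: real^'p. (0 :: real^'q, - s))"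
      by (auto intro!: linearI)
    ultimately show ?thesis
      unfolding gs_def by (simp only: inner_gradient_half_norm_power2) (simp add: q_def algebra_simps)
  qed
  have "inner gy h = - inner r h" for h
  proof -
    have "(\<lambda>y'. f k u w (X, s, y')) = (\<lambda>y'. 1/2 * (norm ((- y', 0 :: real^'p) - (- (\<A> X - b - lam k *\<^sub>R u), - q)))\<^sup>2)"
      by (auto simp: fun_eq_iff f_def norm_prod_def q_def algebra_simps)
    moreover have "linear (\<lambda>y :: real^'q. (- y, 0 :: real^'p))"
      by (auto intro!: linearI)
    ultimately show ?thesis
      unfolding gy_def by (simp only: inner_gradient_half_norm_power2) (simp add: r_def algebra_simps)
  qed
  \<comment> \<open>An identity of vectors is required here, since \<open>gy\<close> also occurs
    inside the projection.\<close>
  then have "\<forall>h. inner h gy = inner h (- r)" by (simp add: inner_commute)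
  then have gy: "gy = - r" by (rule vector_eq_ldot[THEN iffD1])
  obtain G H g h where H: "H \<in> subdifferential (sv_norm \<alpha>) X" and G: "G = (lam k * \<mu>\<^sub>1) *\<^sub>R H + gX"
    and h: "h \<in> subdifferential (vec_norm \<beta>) s" and g: "g = (lam k * \<mu>\<^sub>2) *\<^sub>R h + gs"
    and small: "sqrt ((norm G)\<^sup>2 + (norm g)\<^sup>2) \<le> \<tau> k"
    and proj: "norm (y - closest_point Q (y - (1 / L) *\<^sub>R gy)) \<le> \<xi> k"
    using stop unfolding GRADstop_def gX_def gs_def gy_def by auto
  have "inner (gradient (f k u w) (X, s, y)) ((X', s', y') - (X, s, y))
      = inner gX (X' - X) + inner gs (s' - s) - inner r (y' - y)"
    unfolding inner_gradient_f gX gs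
    by (simp add: T_def r_def q_def inner_diff_right inner_diff_left inner_add_left algebra_simps)
  then have "f k u w (X, s, y) + inner gX (X' - X) + inner gs (s' - s) - inner r (y' - y) \<le> f k u w (X', s', y')"
    using f_subgradient[of k u w "(X, s, y)" "(X', s', y')"] by simp
  moreover have "lam k * \<mu>\<^sub>1 * (sv_norm \<alpha> X + inner H (X' - X)) \<le> lam k * \<mu>\<^sub>1 * sv_norm \<alpha> X'"
    using subdifferential_D[OF H] lam \<mu>\<^sub>1_pos by (intro mult_left_mono) auto
  moreover have "lam k * \<mu>\<^sub>2 * (vec_norm \<beta> s + inner h (s' - s)) \<le> lam k * \<mu>\<^sub>2 * vec_norm \<beta> s'"
    using subdifferential_D[OF h] lam \<mu>\<^sub>2_pos by (intro mult_left_mono) auto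
  ultimately have main: "P k u w (X, s, y) + inner G (X' - X) + inner g (s' - s) - inner r (y' - y) \<le> P k u w (X', s', y')"
    by (simp add: P_def p_def G g inner_add_left algebra_simps)
  have "norm G \<le> \<tau> k" "norm g \<le> \<tau> k"
    using small real_sqrt_sum_squares_ge1[of "norm G" "norm g"] real_sqrt_sum_squares_ge2[of "norm g" "norm G"]
    by linarith+
  then have "\<bar>inner G (X' - X)\<bar> \<le> \<tau> k * norm (X' - X)" "\<bar>inner g (s' - s)\<bar> \<le> \<tau> k * norm (s' - s)"
    by (meson Cauchy_Schwarz_ineq2 mult_right_mono norm_ge_zero order_trans)+
  then show "P k u w (X, s, y) \<le> P k u w (X', s', y') + \<tau> k * (norm (X' - X) + norm (s' - s)) + inner r (y' - y)"
    using main by (simp add: distrib_left)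
  assume "y' \<in> Q"
  \<comment> \<open>The projected gradient step, as \<open>gy = - r\<close>. The projection
    inequality holds at \<open>c\<close>, and the stopping test carries it over to \<open>y\<close>
    at a cost governed by \<open>\<xi> k\<close>.\<close>
  define c where "c = closest_point Q (y + (1 / L) *\<^sub>R r)"
  have c: "norm (c - y) \<le> \<xi> k" using proj by (simp add: gy c_def norm_minus_commute)
  have "inner (y + (1 / L) *\<^sub>R r - c) (y' - c) \<le> 0"
    unfolding c_def by (rule closest_point_dot[OF Q_convex Q_closed \<open>y' \<in> Q\<close>])
  then have "(1 / L) * inner r (y' - c) \<le> inner (c - y) (y' - c)"
    by (simp add: inner_add_left inner_diff_left)
  then have "inner r (y' - c) \<le> L * inner (c - y) (y' - c)"
    using L_pos by (simp add: field_simps)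
  also have "\<dots> \<le> L * (norm (c - y) * norm (y' - c))"
    using L_pos by (intro mult_left_mono norm_cauchy_schwarz) auto
  also have "\<dots> \<le> L * (\<xi> k * (norm (y' - y) + \<xi> k))"
  proof (intro mult_left_mono mult_mono)
    show "norm (y' - c) \<le> norm (y' - y) + \<xi> k"
      using norm_triangle_ineq4[of "y' - y" "c - y"] c by simp
    show "0 \<le> \<xi> k" using c norm_ge_zero order_trans by blast
  qed (use c L_pos in auto)
  finally have "inner r (y' - c) \<le> L * \<xi> k * (norm (y' - y) + \<xi> k)" by (simp add: mult.assoc)
  moreover have "inner r (c - y) \<le> \<xi> k * norm r"
    using norm_cauchy_schwarz[of r "c - y"] mult_left_mono[OF c norm_ge_zero[of r]] by (simp add: mult.commute)
  moreover have "inner r (y' - y) = inner r (y' - c) + inner r (c - y)" by (simp add: inner_diff_right)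
  ultimately show "inner r (y' - y) \<le> L * \<xi> k * (norm (y' - y) + \<xi> k) + \<xi> k * norm r" by linarith
qed

text \<open>The errors of the two stopping rules are added, so later proofs need not know which one
  fired. Keeping \<open>y\<close> avoids the \<open>\<xi>\<close> terms; the general form admits any
  \<open>y'\<close> in \<open>Q\<close>.\<close>

lemma APG_error:
  assumes pos: "lam k > 0" "\<epsilon> k > 0" "\<tau> k > 0" "\<xi> k > 0"
    and X0: "\<A> X0 - b \<in> Q" and z: "snd (snd z) \<in> Q"
    and APG: "APG X0 k u w z (X, s, y)"
  shows "y \<in> Q"
    and "P k u w (X, s, y) \<le> P k u w (X', s', y) + \<epsilon> k + \<tau> k * (norm (X' - X) + norm (s' - s))"
    and "y' \<in> Q \<Longrightarrow> P k u w (X, s, y) \<le> P k u w (X', s', y') + \<epsilon> k + \<tau> k * (norm (X' - X) + norm (s' - s))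
      + (L * \<xi> k * (norm (y' - y) + \<xi> k) + \<xi> k * norm (\<A> X - y - b - lam k *\<^sub>R u))"
proof -
  obtain z1 z2 and t :: "nat \<Rightarrow> real" and N where run: "z1 0 = z" "z2 1 = z" "t 1 = 1"
    and steps: "\<And>l. l \<in> {1..N} \<Longrightarrow>
        is_arg_min
          (\<lambda>v. p k v + inner (gradient (f k u w) (z2 l)) (v - z2 l) + L / 2 * (norm (v - z2 l))\<^sup>2)
          (\<lambda>v. v \<in> S X0 k u w \<and> snd (snd v) \<in> Q)
          (z1 l) \<and>
        t (l + 1) = (1 + sqrt (1 + 4 * (t l)\<^sup>2)) / 2 \<and>
        z2 (l + 1) = z1 l + ((t l - 1) / t (l + 1)) *\<^sub>R (z1 l - z1 (l - 1))"
    and stop: "real N \<ge> lmax X0 k u w z \<or> GRADstop k u w (z1 N)" and z1N: "(X, s, y) = z1 N"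
    using APG unfolding APG_def by blast
  \<comment> \<open>If no step was made, the output is the starting point \<open>z\<close>, and
    membership is inherited from it.\<close>
  have "snd (snd (z1 N)) \<in> Q"
    using steps[of N] run(1) z by (cases "N = 0") (auto simp: is_arg_min_def)
  then show yQ: "y \<in> Q" by (simp flip: z1N)
  define E where "E = L * \<xi> k * (norm (y' - y) + \<xi> k) + \<xi> k * norm (\<A> X - y - b - lam k *\<^sub>R u)"
  have nn: "0 \<le> \<tau> k * (norm (X' - X) + norm (s' - s))" "0 \<le> E"
    using pos L_pos by (auto simp: E_def)
  have "P k u w (X, s, y) \<le> P k u w (X', s', y) + \<epsilon> k + \<tau> k * (norm (X' - X) + norm (s' - s)) \<and>
    (y' \<in> Q \<longrightarrow> P k u w (X, s, y) \<le> P k u w (X', s', y') + \<epsilon> k + \<tau> k * (norm (X' - X) + norm (s' - s)) + E)"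
    using stop
  proof
    assume iter: "real N \<ge> lmax X0 k u w z"
    have "P k u w (X, s, y) \<le> P k u w v + \<epsilon> k" if "snd (snd v) \<in> Q" for v
      unfolding z1N using pos(1,2) X0 run(2,1,3) steps iter that by (rule ITERstop_error)
    from this[of "(X', s', y)"] this[of "(X', s', y')"] show ?thesis
      using yQ nn by auto
  next
    assume grad: "GRADstop k u w (z1 N)"
    note err = GRADstop_error[OF pos(1) grad[folded z1N] refl]
    show ?thesis
      using err(1)[of X' s' y] err(1)[of X' s' y'] err(2)[of y'] pos(2) by (auto simp: E_def)
  qed
  then show "P k u w (X, s, y) \<le> P k u w (X', s', y) + \<epsilon> k + \<tau> k * (norm (X' - X) + norm (s' - s))"
    and "y' \<in> Q \<Longrightarrow> P k u w (X, s, y) \<le> P k u w (X', s', y') + \<epsilon> k + \<tau> k * (norm (X' - X) + norm (s' - s))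
      + (L * \<xi> k * (norm (y' - y) + \<xi> k) + \<xi> k * norm (\<A> X - y - b - lam k *\<^sub>R u))"
    by (simp_all add: E_def)
qed

subsection \<open>Boundedness of the multipliers and convergence\<close>

context
  fixes X :: "nat \<Rightarrow> real^'n^'m" and s :: "nat \<Rightarrow> real^'p" and y :: "nat \<Rightarrow> real^'q"
    and \<theta>\<^sub>1 :: "nat \<Rightarrow> real^'q" and \<theta>\<^sub>2 :: "nat \<Rightarrow> real^'p"
  assumes FALC: "FALC X s y \<theta>\<^sub>1 \<theta>\<^sub>2"
    and pos: "\<And>k. k \<ge> 1 \<Longrightarrow> lam k > 0 \<and> \<epsilon> k > 0 \<and> \<tau> k > 0 \<and> \<xi> k > 0"
begin

lemma APG_iterate:
  "k \<ge> 1 \<Longrightarrow> APG (X 0) k (\<theta>\<^sub>1 k) (\<theta>\<^sub>2 k) (X (k - 1), s (k - 1), y (k - 1)) (X k, s k, y k)"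
  using FALC by (simp add: FALC_def)

lemma X0_feasible: "\<A> (X 0) - b \<in> Q"
  using FALC by (simp add: FALC_def)

lemma iterate_y_in_Q: "y k \<in> Q"
proof (induction k)
  case 0
  then show ?case using FALC by (simp add: FALC_def)
next
  case (Suc k)
  then show ?case
    using APG_error(1)[OF _ _ _ _ X0_feasible _ APG_iterate[of "Suc k"]] pos[of "Suc k"] by simp
qed

lemma residual\<^sub>1:
  assumes "k \<ge> 1"
  shows "\<A> (X k) - y k - b - lam k *\<^sub>R \<theta>\<^sub>1 k = - (lam k *\<^sub>R \<theta>\<^sub>1 (Suc k))"
proof -
  have "\<theta>\<^sub>1 (Suc k) = \<theta>\<^sub>1 k - (1 / lam k) *\<^sub>R (\<A> (X k) - y k - b)"
    using FALC assms by (simp add: FALC_def)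
  then show ?thesis using pos[OF assms] by (simp add: scaleR_diff_right)
qed

lemma residual\<^sub>2:
  assumes "k \<ge> 1"
  shows "\<C> (X k) - s k - d - lam k *\<^sub>R \<theta>\<^sub>2 k = - (lam k *\<^sub>R \<theta>\<^sub>2 (Suc k))"
proof -
  have "\<theta>\<^sub>2 (Suc k) = \<theta>\<^sub>2 k - (1 / lam k) *\<^sub>R (\<C> (X k) - s k - d)"
    using FALC assms by (simp add: FALC_def)
  then show ?thesis using pos[OF assms] by (simp add: scaleR_diff_right)
qed

lemma iterate_error_same_y:
  assumes "k \<ge> 1"
  shows "P k (\<theta>\<^sub>1 k) (\<theta>\<^sub>2 k) (X k, s k, y k) \<le> P k (\<theta>\<^sub>1 k) (\<theta>\<^sub>2 k) (X', s', y k)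
    + \<epsilon> k + \<tau> k * (norm (X' - X k) + norm (s' - s k))"
  using APG_error(2)[OF _ _ _ _ X0_feasible _ APG_iterate[OF assms]] pos[OF assms] iterate_y_in_Q by simp

lemma iterate_error:
  assumes "k \<ge> 1" "y' \<in> Q"
  shows "P k (\<theta>\<^sub>1 k) (\<theta>\<^sub>2 k) (X k, s k, y k) \<le> P k (\<theta>\<^sub>1 k) (\<theta>\<^sub>2 k) (X', s', y')
    + \<epsilon> k + \<tau> k * (norm (X' - X k) + norm (s' - s k))
    + (L * \<xi> k * (norm (y' - y k) + \<xi> k) + \<xi> k * (lam k * norm (\<theta>\<^sub>1 (Suc k))))"
  using APG_error(3)[OF _ _ _ _ X0_feasible _ APG_iterate[OF assms(1)] assms(2)] pos[OF assms(1)] iterate_y_in_Q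
  by (simp add: residual\<^sub>1[OF assms(1)])

context
  fixes B B' :: real
  assumes \<epsilon>_le: "\<And>k. k \<ge> 1 \<Longrightarrow> \<epsilon> k \<le> B * (lam k)\<^sup>2"
    and \<tau>_le: "\<And>k. k \<ge> 1 \<Longrightarrow> \<tau> k \<le> B' * lam k"
begin

lemma B_nonneg: "0 \<le> B" "0 \<le> B'"
proof -
  have "0 < B * (lam 1)\<^sup>2" "0 < B' * lam 1"
    using \<epsilon>_le[of 1] \<tau>_le[of 1] pos[of 1] by linarith+
  then show "0 \<le> B" "0 \<le> B'" using pos[of 1] by (simp_all add: zero_less_mult_iff)
qed

text \<open>Comparison with the point \<open>s'\<close> that annihilates the second residual.\<close>

lemma \<theta>\<^sub>2_bounded: "\<exists>c. \<forall>k\<ge>1. norm (\<theta>\<^sub>2 (Suc k)) \<le> c"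
proof (intro exI allI impI)
  fix k :: nat assume k: "k \<ge> 1"
  define a where "a = \<mu>\<^sub>2 * real CARD('p) + B'"
  define m where "m = norm (\<theta>\<^sub>2 (Suc k))"
  define q where "q = \<C> (X k) - s k - d - lam k *\<^sub>R \<theta>\<^sub>2 k"
  have lam: "lam k > 0" using pos[OF k] by simp
  have q: "norm q = lam k * m"
    using lam by (simp add: q_def residual\<^sub>2[OF k] m_def)
  have "P k (\<theta>\<^sub>1 k) (\<theta>\<^sub>2 k) (X k, s k, y k)
      \<le> P k (\<theta>\<^sub>1 k) (\<theta>\<^sub>2 k) (X k, s k + q, y k) + \<epsilon> k + \<tau> k * norm q"
    using iterate_error_same_y[OF k, of "X k" "s k + q"] by simp
  moreover have "P k (\<theta>\<^sub>1 k) (\<theta>\<^sub>2 k) (X k, s k + q, y k)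
      = P k (\<theta>\<^sub>1 k) (\<theta>\<^sub>2 k) (X k, s k, y k) - 1/2 * (norm q)\<^sup>2
        + lam k * \<mu>\<^sub>2 * (vec_norm \<beta> (s k + q) - vec_norm \<beta> (s k))"
    by (simp add: P_def f_def p_def q_def algebra_simps)
  moreover have "lam k * \<mu>\<^sub>2 * (vec_norm \<beta> (s k + q) - vec_norm \<beta> (s k)) \<le> lam k * \<mu>\<^sub>2 * (real CARD('p) * norm q)"
    using vec_norm_triangle[OF \<beta>, of "s k" q] vec_norm_le_norm[OF \<beta>, of q] lam \<mu>\<^sub>2_pos
    by (intro mult_left_mono) auto
  moreover have "\<tau> k * norm q \<le> B' * lam k * norm q"
    using \<tau>_le[OF k] by (intro mult_right_mono) auto
  ultimately have "1/2 * (norm q)\<^sup>2 \<le> lam k * \<mu>\<^sub>2 * (real CARD('p) * norm q) + B' * lam k * norm q + B * (lam k)\<^sup>2"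
    using \<epsilon>_le[OF k] by linarith
  then have "(lam k)\<^sup>2 * (1/2 * m\<^sup>2) \<le> (lam k)\<^sup>2 * (a * m + B)"
    by (simp add: q a_def power2_eq_square algebra_simps)
  then have "1/2 * m\<^sup>2 \<le> a * m + B" using lam by simp
  moreover have "0 \<le> a" using \<mu>\<^sub>2_pos B_nonneg by (simp add: a_def)
  ultimately show "norm (\<theta>\<^sub>2 (Suc k)) \<le> (\<mu>\<^sub>2 * real CARD('p) + B' + B) / (1/2) + 1"
    using B_nonneg le_of_quadratic_le[of "1/2" a B m] unfolding m_def a_def by simp
qed

text \<open>Comparison with a step \<open>X' - X k\<close> along a right inverse of \<open>\<A>\<close> that shrinks the first
  residual; its length \<open>t\<close> is small enough for the change of the second residual to be absorbed.\<close>

lemma \<theta>\<^sub>1_bounded: "\<exists>c. \<forall>k\<ge>1. norm (\<theta>\<^sub>1 (Suc k)) \<le> c"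
proof -
  obtain R where R: "linear R" and \<A>R: "\<And>v. \<A> (R v) = v"
    using linear_surjective_right_inverse[OF lin\<A> surj\<A>] by (auto simp: fun_eq_iff)
  obtain \<kappa> where \<kappa>: "\<kappa> > 0" "\<And>v. norm (R v) \<le> \<kappa> * norm v"
    using linear_bounded_pos[OF R] by blast
  obtain c where c: "c > 0" "\<And>v. norm ((\<C> \<circ> R) v) \<le> c * norm v"
    using linear_bounded_pos[OF linear_compose[OF R lin\<C>]] by blast
  \<comment> \<open>The step will change the second residual by \<open>\<C> D\<close>; the cross
    term between the two is controlled by this bound.\<close>
  obtain c2 where c2: "\<And>k. k \<ge> 1 \<Longrightarrow> norm (\<theta>\<^sub>2 (Suc k)) \<le> c2" using \<theta>\<^sub>2_bounded by blast
  have "0 \<le> c2" using c2[of 1] norm_ge_zero order_trans by blast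
  \<comment> \<open>The maximizer of \<open>t - t^2 * (1 + c^2) / 2\<close>, the net coefficient of
    the squared norm of \<open>r\<close> gained by the step; the gain is then
    \<open>t / 2\<close>.\<close>
  define t where "t = 1 / (1 + c\<^sup>2)"
  have den: "1 + c\<^sup>2 > 0" by (simp add: add_pos_nonneg)
  then have t: "t > 0" and tc: "t * (1 + c\<^sup>2) = 1" by (simp_all add: t_def)
  define a where "a = \<mu>\<^sub>1 * real CARD('n) * \<kappa> * t + B' * \<kappa> * t + c * c2 * t"
  have "norm (\<theta>\<^sub>1 (Suc k)) \<le> (a + B) / (t / 2) + 1" if k: "k \<ge> 1" for k
  proof -
    define m where "m = norm (\<theta>\<^sub>1 (Suc k))"
    define r where "r = \<A> (X k) - y k - b - lam k *\<^sub>R \<theta>\<^sub>1 k"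
    define q where "q = \<C> (X k) - s k - d - lam k *\<^sub>R \<theta>\<^sub>2 k"
    define D where "D = R (- (t *\<^sub>R r))"
    have lam: "lam k > 0" using pos[OF k] by simp
    have r: "norm r = lam k * m" using lam by (simp add: r_def residual\<^sub>1[OF k] m_def)
    have q: "norm q \<le> lam k * c2" using lam c2[OF k] by (simp add: q_def residual\<^sub>2[OF k])
    have D: "norm D \<le> \<kappa> * t * norm r" using \<kappa>(2)[of "- (t *\<^sub>R r)"] t by (simp add: D_def mult.assoc)
    have CD: "norm (\<C> D) \<le> c * t * norm r" using c(2)[of "- (t *\<^sub>R r)"] t by (simp add: D_def mult.assoc)
    have f1: "\<A> (X k + D) - y k - b - lam k *\<^sub>R \<theta>\<^sub>1 k = (1 - t) *\<^sub>R r"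
      by (simp add: linear_add[OF lin\<A>] D_def \<A>R r_def algebra_simps)
    have f2: "\<C> (X k + D) - s k - d - lam k *\<^sub>R \<theta>\<^sub>2 k = q + \<C> D"
      by (simp add: linear_add[OF lin\<C>] q_def algebra_simps)
    have "P k (\<theta>\<^sub>1 k) (\<theta>\<^sub>2 k) (X k + D, s k, y k)
        = lam k * (\<mu>\<^sub>1 * sv_norm \<alpha> (X k + D) + \<mu>\<^sub>2 * vec_norm \<beta> (s k))
          + 1/2 * (norm ((1 - t) *\<^sub>R r))\<^sup>2 + 1/2 * (norm (q + \<C> D))\<^sup>2"
      unfolding f1[symmetric] f2[symmetric] by (simp add: P_def f_def p_def)
    moreover have "P k (\<theta>\<^sub>1 k) (\<theta>\<^sub>2 k) (X k, s k, y k)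
        = lam k * (\<mu>\<^sub>1 * sv_norm \<alpha> (X k) + \<mu>\<^sub>2 * vec_norm \<beta> (s k)) + 1/2 * (norm r)\<^sup>2 + 1/2 * (norm q)\<^sup>2"
      by (simp add: P_def f_def p_def r_def q_def)
    moreover have "P k (\<theta>\<^sub>1 k) (\<theta>\<^sub>2 k) (X k, s k, y k)
        \<le> P k (\<theta>\<^sub>1 k) (\<theta>\<^sub>2 k) (X k + D, s k, y k) + \<epsilon> k + \<tau> k * norm D"
      using iterate_error_same_y[OF k, of "X k + D" "s k"] by simp
    moreover have "1/2 * (norm ((1 - t) *\<^sub>R r))\<^sup>2 = 1/2 * (norm r)\<^sup>2 - t * (norm r)\<^sup>2 + 1/2 * t\<^sup>2 * (norm r)\<^sup>2"
      by (simp only: norm_scaleR power_mult_distrib power2_abs) (simp add: power2_eq_square algebra_simps)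
    moreover have "1/2 * (norm (q + \<C> D))\<^sup>2 \<le> 1/2 * (norm q)\<^sup>2 + lam k * c2 * (c * t * norm r) + 1/2 * (c * t * norm r)\<^sup>2"
    proof -
      have "inner q (\<C> D) \<le> (lam k * c2) * (c * t * norm r)"
        using lam \<open>0 \<le> c2\<close> by (intro order_trans[OF norm_cauchy_schwarz] mult_mono q CD) auto
      moreover have "(norm (\<C> D))\<^sup>2 \<le> (c * t * norm r)\<^sup>2" by (intro power_mono CD) auto
      moreover have "(norm (q + \<C> D))\<^sup>2 = (norm q)\<^sup>2 + 2 * inner q (\<C> D) + (norm (\<C> D))\<^sup>2"
        by (simp add: power2_norm_eq_inner inner_add_left inner_add_right inner_commute)
      ultimately show ?thesis by linarith
    qed
    moreover have "\<tau> k * norm D \<le> B' * lam k * (\<kappa> * t * norm r)"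
      using \<tau>_le[OF k] D pos[OF k] B_nonneg by (intro mult_mono) auto
    moreover have "lam k * (\<mu>\<^sub>1 * sv_norm \<alpha> (X k + D)) \<le> lam k * (\<mu>\<^sub>1 * sv_norm \<alpha> (X k))
        + lam k * (\<mu>\<^sub>1 * (real CARD('n) * (\<kappa> * t * norm r)))"
    proof -
      have "sv_norm \<alpha> (X k + D) \<le> sv_norm \<alpha> (X k) + real CARD('n) * norm D"
        using sv_norm_triangle[OF \<alpha>, of "X k" D] sv_norm_le_norm[OF \<alpha>, of D] by linarith
      also have "\<dots> \<le> sv_norm \<alpha> (X k) + real CARD('n) * (\<kappa> * t * norm r)"
        using D by (intro add_left_mono mult_left_mono) auto
      finally have "lam k * \<mu>\<^sub>1 * sv_norm \<alpha> (X k + D) \<le> lam k * \<mu>\<^sub>1 * (sv_norm \<alpha> (X k) + real CARD('n) * (\<kappa> * t * norm r))"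
        using lam \<mu>\<^sub>1_pos by (intro mult_left_mono) auto
      then show ?thesis by (simp add: algebra_simps)
    qed
    ultimately have "t * (norm r)\<^sup>2 - 1/2 * t\<^sup>2 * (norm r)\<^sup>2 - 1/2 * (c * t * norm r)\<^sup>2
        \<le> lam k * (\<mu>\<^sub>1 * (real CARD('n) * (\<kappa> * t * norm r))) + lam k * c2 * (c * t * norm r)
          + B' * lam k * (\<kappa> * t * norm r) + B * (lam k)\<^sup>2"
      using \<epsilon>_le[OF k] by (simp only: distrib_left)
    moreover have "t * (norm r)\<^sup>2 - 1/2 * t\<^sup>2 * (norm r)\<^sup>2 - 1/2 * (c * t * norm r)\<^sup>2
        = t * (norm r)\<^sup>2 - 1/2 * (t * (1 + c\<^sup>2)) * (t * (norm r)\<^sup>2)"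
      by (simp add: power_mult_distrib power2_eq_square algebra_simps)
    ultimately have "(lam k)\<^sup>2 * (t / 2 * m\<^sup>2) \<le> (lam k)\<^sup>2 * (a * m + B)"
      unfolding tc by (simp add: r a_def power2_eq_square algebra_simps)
    then have "t / 2 * m\<^sup>2 \<le> a * m + B" using lam by simp
    moreover have "0 \<le> a"
      using \<mu>\<^sub>1_pos B_nonneg \<kappa>(1) c(1) t \<open>0 \<le> c2\<close> by (simp add: a_def)
    ultimately show ?thesis
      using B_nonneg t le_of_quadratic_le[of "t / 2" a B m] unfolding m_def by simp
  qed
  then show ?thesis by blast
qed

lemma multipliers_bounded:
  obtains K where "\<And>k. k \<ge> 1 \<Longrightarrow> norm (\<theta>\<^sub>1 k) \<le> K" "\<And>k. k \<ge> 1 \<Longrightarrow> norm (\<theta>\<^sub>2 k) \<le> K"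
proof -
  obtain c1 c2 where c: "\<And>k. k \<ge> 1 \<Longrightarrow> norm (\<theta>\<^sub>1 (Suc k)) \<le> c1" "\<And>k. k \<ge> 1 \<Longrightarrow> norm (\<theta>\<^sub>2 (Suc k)) \<le> c2"
    using \<theta>\<^sub>1_bounded \<theta>\<^sub>2_bounded by blast
  have init: "\<theta>\<^sub>1 1 = 0" "\<theta>\<^sub>2 1 = 0" using FALC by (simp_all add: FALC_def)
  \<comment> \<open>The shifted bounds start at index 2; the zero multipliers at index 1 account for
    the outer \<open>max\<close>.\<close>
  have "norm (\<theta>\<^sub>1 k) \<le> max 0 (max c1 c2)" "norm (\<theta>\<^sub>2 k) \<le> max 0 (max c1 c2)" if "k \<ge> 1" for k
    using that c[of "k - 1"] init by (cases "k = 1"; force simp: le_max_iff_disj)+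
  then show ?thesis using that by blast
qed

section \<open>Optimality of limit points\<close>

lemma limit_point_optimal:
  assumes lam0: "lam \<longlonglongrightarrow> 0"
    and \<tau>0: "(\<lambda>k. \<tau> k / lam k) \<longlonglongrightarrow> 0" and \<xi>0: "(\<lambda>k. \<xi> k / lam k) \<longlonglongrightarrow> 0"
    and \<rho>: "strict_mono \<rho>" and lim: "(X \<circ> \<rho>) \<longlonglongrightarrow> Xbar"
  shows "is_arg_min objective (\<lambda>Z. \<A> Z - b \<in> Q) Xbar"
proof -
  obtain K where K: "\<And>k. k \<ge> 1 \<Longrightarrow> norm (\<theta>\<^sub>1 k) \<le> K" "\<And>k. k \<ge> 1 \<Longrightarrow> norm (\<theta>\<^sub>2 k) \<le> K"
    using multipliers_bounded by blast
  have "0 \<le> K" using K(1)[of 1] norm_ge_zero order_trans by blast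
  \<comment> \<open>\<open>\<rho> 0\<close> may be 0, an index for which neither positive parameters
    nor update equations are given; the shift keeps all indices at least 1.\<close>
  define \<sigma> where "\<sigma> n = \<rho> (Suc n)" for n
  have \<sigma>1: "\<sigma> n \<ge> 1" for n
    using seq_suble[OF \<rho>, of "Suc n"] by (simp add: \<sigma>_def)
  have sub: "(\<lambda>n. a (\<sigma> n)) \<longlonglongrightarrow> l" if "a \<longlonglongrightarrow> l" for a :: "nat \<Rightarrow> real" and l
    using LIMSEQ_Suc[OF LIMSEQ_subseq_LIMSEQ[OF that \<rho>]] by (simp add: \<sigma>_def comp_def)
  have X: "(\<lambda>n. X (\<sigma> n)) \<longlonglongrightarrow> Xbar"
    using LIMSEQ_Suc[OF lim] by (simp add: \<sigma>_def comp_def)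
  have \<A>X: "(\<lambda>n. \<A> (X (\<sigma> n))) \<longlonglongrightarrow> \<A> Xbar" and \<C>X: "(\<lambda>n. \<C> (X (\<sigma> n))) \<longlonglongrightarrow> \<C> Xbar"
    by (auto intro!: bounded_linear.tendsto[OF _ X] simp: lin\<A> lin\<C> linear_conv_bounded_linear[symmetric])
  \<comment> \<open>By the multiplier updates these differences are the constraint residuals
    \<open>\<A> X - y - b\<close> and \<open>\<C> X - s - d\<close>, which therefore vanish in the
    limit.\<close>
  have small: "(\<lambda>n. lam (\<sigma> n) *\<^sub>R (\<theta> (\<sigma> n) - \<theta> (Suc (\<sigma> n)))) \<longlonglongrightarrow> 0"
    if "\<And>k. k \<ge> 1 \<Longrightarrow> norm (\<theta> k) \<le> K" for \<theta> :: "nat \<Rightarrow> 'z::real_normed_vector"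
  proof (rule Lim_null_comparison)
    show "\<forall>\<^sub>F n in sequentially. norm (lam (\<sigma> n) *\<^sub>R (\<theta> (\<sigma> n) - \<theta> (Suc (\<sigma> n)))) \<le> lam (\<sigma> n) * (K + K)"
    proof (intro always_eventually allI)
      fix n
      have "norm (\<theta> (\<sigma> n) - \<theta> (Suc (\<sigma> n))) \<le> K + K"
        using \<sigma>1[of n] by (intro order_trans[OF norm_triangle_ineq4] add_mono that) auto
      then show "norm (lam (\<sigma> n) *\<^sub>R (\<theta> (\<sigma> n) - \<theta> (Suc (\<sigma> n)))) \<le> lam (\<sigma> n) * (K + K)"
        using pos[OF \<sigma>1, of n] by simp
    qed
    show "(\<lambda>n. lam (\<sigma> n) * (K + K)) \<longlonglongrightarrow> 0"
      using tendsto_mult_left_zero[OF sub[OF lam0]] by simp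
  qed
  have "y (\<sigma> n) = \<A> (X (\<sigma> n)) - b - lam (\<sigma> n) *\<^sub>R (\<theta>\<^sub>1 (\<sigma> n) - \<theta>\<^sub>1 (Suc (\<sigma> n)))" for n
    using residual\<^sub>1[OF \<sigma>1, of n] by (simp add: algebra_simps)
  then have y: "(\<lambda>n. y (\<sigma> n)) \<longlonglongrightarrow> \<A> Xbar - b"
    using tendsto_diff[OF tendsto_diff[OF \<A>X tendsto_const[of b]] small[OF K(1)]] by simp
  have "s (\<sigma> n) = \<C> (X (\<sigma> n)) - d - lam (\<sigma> n) *\<^sub>R (\<theta>\<^sub>2 (\<sigma> n) - \<theta>\<^sub>2 (Suc (\<sigma> n)))" for n
    using residual\<^sub>2[OF \<sigma>1, of n] by (simp add: algebra_simps)
  then have s: "(\<lambda>n. s (\<sigma> n)) \<longlonglongrightarrow> \<C> Xbar - d"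
    using tendsto_diff[OF tendsto_diff[OF \<C>X tendsto_const[of d]] small[OF K(2)]] by simp
  have feasible: "\<A> Xbar - b \<in> Q"
    using closed_sequentially[OF Q_closed _ y] iterate_y_in_Q by blast
  have "continuous_on UNIV (sv_norm \<alpha> :: real^'n^'m \<Rightarrow> real)"
    by (rule convex_on_continuous[OF open_UNIV convex_on_sv_norm[OF \<alpha>]])
  moreover have "continuous_on UNIV (vec_norm \<beta> :: real^'p \<Rightarrow> real)"
    by (rule convex_on_continuous[OF open_UNIV convex_on_vec_norm[OF \<beta>]])
  ultimately have "isCont (sv_norm \<alpha>) Xbar" "isCont (vec_norm \<beta>) (\<C> Xbar - d)"
    by (simp_all add: continuous_on_eq_continuous_at)
  then have lhs: "(\<lambda>n. \<mu>\<^sub>1 * sv_norm \<alpha> (X (\<sigma> n)) + \<mu>\<^sub>2 * vec_norm \<beta> (s (\<sigma> n))) \<longlonglongrightarrow> objective Xbar"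
    unfolding objective_def by (intro tendsto_intros isCont_tendsto_compose[OF _ X] isCont_tendsto_compose[OF _ s])
  have "objective Xbar \<le> objective Z" if Z: "\<A> Z - b \<in> Q" for Z
  proof -
    let ?E = "\<lambda>n. norm (Z - X (\<sigma> n)) + norm (\<C> Z - d - s (\<sigma> n))"
    let ?F = "\<lambda>n. norm (\<A> Z - b - y (\<sigma> n)) + \<xi> (\<sigma> n)"
    \<comment> \<open>The error inequality at \<open>Z\<close>, divided by \<open>lam k\<close>. The
      residuals at the comparison point are minus \<open>lam k\<close> times the multipliers and
      contribute at most \<open>lam k * K\<^sup>2\<close> after division; the summand with
      \<open>B\<close> comes from \<open>\<epsilon> k\<close>.\<close>
    let ?rhs = "\<lambda>n. objective Z + lam (\<sigma> n) * (K\<^sup>2 + B) + \<tau> (\<sigma> n) / lam (\<sigma> n) * ?E n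
        + (L * (\<xi> (\<sigma> n) / lam (\<sigma> n)) * ?F n + \<xi> (\<sigma> n) / lam (\<sigma> n) * (lam (\<sigma> n) * K))"
    have "\<xi> (\<sigma> n) = \<xi> (\<sigma> n) / lam (\<sigma> n) * lam (\<sigma> n)" for n
      using pos[OF \<sigma>1, of n] by simp
    then have \<xi>lim: "(\<lambda>n. \<xi> (\<sigma> n)) \<longlonglongrightarrow> 0"
      using tendsto_mult_zero[OF sub[OF \<xi>0] sub[OF lam0]] by simp
    have rhs: "?rhs \<longlonglongrightarrow> objective Z + 0 * (K\<^sup>2 + B) + 0 * (norm (Z - Xbar) + norm (\<C> Z - d - (\<C> Xbar - d)))
        + (L * 0 * (norm (\<A> Z - b - (\<A> Xbar - b)) + 0) + 0 * (0 * K))"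
      by (intro tendsto_intros X s y sub[OF lam0] sub[OF \<tau>0] sub[OF \<xi>0] \<xi>lim)
    have "\<mu>\<^sub>1 * sv_norm \<alpha> (X (\<sigma> n)) + \<mu>\<^sub>2 * vec_norm \<beta> (s (\<sigma> n)) \<le> ?rhs n" for n
    proof -
      define k where "k = \<sigma> n"
      have k: "k \<ge> 1" using \<sigma>1 by (simp add: k_def)
      have lam: "lam k > 0" and \<xi>: "\<xi> k > 0" using pos[OF k] by auto
      have "p k (X k, s k, y k) \<le> P k (\<theta>\<^sub>1 k) (\<theta>\<^sub>2 k) (X k, s k, y k)"
        by (simp add: P_def f_nonneg)
      also have "\<dots> \<le> P k (\<theta>\<^sub>1 k) (\<theta>\<^sub>2 k) (Z, \<C> Z - d, \<A> Z - b)
          + \<epsilon> k + \<tau> k * (norm (Z - X k) + norm (\<C> Z - d - s k))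
          + (L * \<xi> k * (norm (\<A> Z - b - y k) + \<xi> k) + \<xi> k * (lam k * norm (\<theta>\<^sub>1 (Suc k))))"
        by (rule iterate_error[OF k Z])
      also have "P k (\<theta>\<^sub>1 k) (\<theta>\<^sub>2 k) (Z, \<C> Z - d, \<A> Z - b)
          = lam k * objective Z + (lam k)\<^sup>2 / 2 * ((norm (\<theta>\<^sub>1 k))\<^sup>2 + (norm (\<theta>\<^sub>2 k))\<^sup>2)"
        by (simp add: P_def p_def f_def objective_def power_mult_distrib algebra_simps)
      also have "(lam k)\<^sup>2 / 2 * ((norm (\<theta>\<^sub>1 k))\<^sup>2 + (norm (\<theta>\<^sub>2 k))\<^sup>2) \<le> (lam k)\<^sup>2 / 2 * (K\<^sup>2 + K\<^sup>2)"
        using K[OF k] by (intro mult_left_mono add_mono power_mono) auto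
      also have "\<epsilon> k \<le> B * (lam k)\<^sup>2" by (rule \<epsilon>_le[OF k])
      also have "\<xi> k * (lam k * norm (\<theta>\<^sub>1 (Suc k))) \<le> \<xi> k * (lam k * K)"
        using K(1)[of "Suc k"] lam \<xi> by (intro mult_left_mono) auto
      finally have "lam k * (\<mu>\<^sub>1 * sv_norm \<alpha> (X k) + \<mu>\<^sub>2 * vec_norm \<beta> (s k))
          \<le> lam k * objective Z + (lam k)\<^sup>2 / 2 * (K\<^sup>2 + K\<^sup>2) + B * (lam k)\<^sup>2
            + \<tau> k * (norm (Z - X k) + norm (\<C> Z - d - s k))
            + (L * \<xi> k * (norm (\<A> Z - b - y k) + \<xi> k) + \<xi> k * (lam k * K))"
        by (simp add: p_def)
      also have "\<dots> = lam k * ?rhs n"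
      proof -
        have cancel: "a / lam k * e = a * e / lam k" "lam k * (a / lam k) = a" for a e
          using lam by simp_all
        show ?thesis
          using lam unfolding k_def[symmetric] distrib_left cancel times_divide_eq_right
          by (simp add: power2_eq_square algebra_simps)
      qed
      finally have "lam k * (\<mu>\<^sub>1 * sv_norm \<alpha> (X k) + \<mu>\<^sub>2 * vec_norm \<beta> (s k)) \<le> lam k * ?rhs n" .
      then show ?thesis using lam unfolding k_def[symmetric] by simp
    qed
    then show ?thesis using LIMSEQ_le[OF lhs rhs] by auto
  qed
  with feasible show ?thesis by (auto simp: is_arg_min_def not_less)
qed

end

end

end

theorem theorem3p3:
  fixes \<alpha> \<beta> :: enat
    and \<mu>\<^sub>1 \<mu>\<^sub>2 :: real
    and \<A> :: "real^'n^'m \<Rightarrow> real^'q" and A :: "real^('n \<times> 'm)^'q"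
    and \<C> :: "real^'n^'m \<Rightarrow> real^'p" and C :: "real^('n \<times> 'm)^'p"
    and b :: "real^'q" and d :: "real^'p"
    and Q :: "(real^'q) set"
    and lam \<epsilon> \<tau> \<xi> :: "nat \<Rightarrow> real"
    and X :: "nat \<Rightarrow> real^'n^'m" and s :: "nat \<Rightarrow> real^'p" and y :: "nat \<Rightarrow> real^'q"
    and \<theta>\<^sub>1 :: "nat \<Rightarrow> real^'q" and \<theta>\<^sub>2 :: "nat \<Rightarrow> real^'p"
    and Xbar :: "real^'n^'m"
  assumes "\<alpha> \<in> {1, 2, \<infinity>}" and "\<beta> \<in> {1, 2, \<infinity>}"
    and "\<mu>\<^sub>1 > 0" and "\<mu>\<^sub>2 > 0"
    and "linear \<A>" and "surj \<A>" and "\<And>Z. \<A> Z = A *v vectorize Z"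
    and "linear \<C>" and "\<And>Z. \<C> Z = C *v vectorize Z"
    and "Q \<noteq> {}" and "closed Q" and "convex Q"
    and "\<And>k. k \<ge> 1 \<Longrightarrow> lam k > 0 \<and> \<epsilon> k > 0 \<and> \<tau> k > 0 \<and> \<xi> k > 0"
    and "decreases_to_zero lam"
    and "decreases_to_zero \<epsilon>"
    and "\<exists>B>0. \<forall>k\<ge>1. \<epsilon> k / (lam k)\<^sup>2 \<le> B"
    and "decreases_to_zero \<tau>" and "decreases_to_zero \<xi>"
    and "(\<lambda>k. \<tau> k / lam k) \<longlonglongrightarrow> 0" and "(\<lambda>k. \<xi> k / lam k) \<longlonglongrightarrow> 0"
    and "falc.FALC \<alpha> \<beta> \<mu>\<^sub>1 \<mu>\<^sub>2 \<A> A \<C> C b d Q lam \<epsilon> \<tau> \<xi> X s y \<theta>\<^sub>1 \<theta>\<^sub>2"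
    and "\<exists>r. strict_mono r \<and> (X \<circ> r) \<longlonglongrightarrow> Xbar"
  shows "is_arg_min (falc.objective \<alpha> \<beta> \<mu>\<^sub>1 \<mu>\<^sub>2 \<C> d) (\<lambda>Z. \<A> Z - b \<in> Q) Xbar"
proof -
  interpret falc_data \<alpha> \<beta> \<mu>\<^sub>1 \<mu>\<^sub>2 \<A> A \<C> C b d Q lam \<epsilon> \<tau> \<xi>
    by (rule falc_data.intro) (fact assms)+
  note pos = assms(13)
  obtain B where B: "\<And>k. k \<ge> 1 \<Longrightarrow> \<epsilon> k / (lam k)\<^sup>2 \<le> B"
    using assms(16) by blast
  have \<epsilon>_le: "\<epsilon> k \<le> B * (lam k)\<^sup>2" if "k \<ge> 1" for k
    using B[OF that] pos[OF that] by (simp add: divide_le_eq)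
  \<comment> \<open>The ratio converges and is therefore bounded, which supplies the constant for
    the multiplier bounds.\<close>
  obtain B' where B': "\<And>k. norm (\<tau> k / lam k) \<le> B'"
    using convergent_imp_Bseq[OF convergentI[OF assms(19)]] unfolding Bseq_def by blast
  have \<tau>_le: "\<tau> k \<le> B' * lam k" if "k \<ge> 1" for k
    using B'[of k] pos[OF that] by (simp add: divide_le_eq)
  obtain r where "strict_mono r" "(X \<circ> r) \<longlonglongrightarrow> Xbar"
    using assms(22) by blast
  then show ?thesis
    using limit_point_optimal[OF assms(21) pos \<epsilon>_le \<tau>_le] assms(14,19,20)
    by (simp add: decreases_to_zero_def)
qed

end
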